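(* Consider the inexact primal–dual splitting iteration described in the context, with fixed-point operator $\boldsymbol T=J_{\boldsymbol A}\circ(\mathrm{Id}-\boldsymbol B)$ on $\boldsymbol{\mathcal K}$. Suppose that $0<\inf_k\lambda_k\le\sup_k\lambda_k<\frac{4\eta\beta-1}{2\eta\beta}$, that $\sum_k(k+1)\|\varepsilon_{j,k}\|<+\infty$ for $j=1,2$, and that $\sum_k(k+1)\|\varepsilon_{j,i,k}\|<+\infty$ for $j=3,4$ and $i=1,\dots,n$. Then there is a constant $C_1<+\infty$ such that for all $k\in\mathbb N$ $$d\big(0,(\boldsymbol A+\boldsymbol B)\boldsymbol w_{k+1}\big)\le\frac{2\delta}{\eta}\sqrt{\frac{d_0^2+C_1}{\underline\tau(k+1)}},$$ where $d_0=\inf_{\boldsymbol z\in\mathrm{fix}\,\boldsymbol T}\|\boldsymbol z_0-\boldsymbol z\|_{\boldsymbol{\mathcal K}}$ and the distance is taken in $\boldsymbol{\mathcal K}$.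
   Context: Problem: $\mathcal H,\mathcal G_1,\dots,\mathcal G_n$ are real Hilbert spaces; $C:\mathcal H\to2^{\mathcal H}$ is maximal monotone; $B:\mathcal H\to\mathcal H$ is $\mu$-cocoercive ($\mu\|Bx-By\|^2\le\langle Bx-By,x-y\rangle$), $\mu>0$; $\omega_i\in(0,1)$, $\sum_i\omega_i=1$; $r_i\in\mathcal G_i$; $A_i:\mathcal G_i\to2^{\mathcal G_i}$ is maximal monotone; $D_i:\mathcal G_i\to2^{\mathcal G_i}$ is maximal monotone and $\nu_i$-strongly monotone, $\nu_i>0$ (so $D_i^{-1}$ is single-valued); $L_i:\mathcal H\to\mathcal G_i$ is a non-zero bounded linear operator. With $A_i\square D_i=(A_i^{-1}+D_i^{-1})^{-1}$, the primal problem is to find $x$ with $0\in Cx+Bx+\sum_i\omega_iL_i^*\big((A_i\square D_i)(L_ix-r_i)\big)$, and the dual is to find $(v_i)_i$ such that for some $x$: $0\in Cx+Bx+\sum_i\omega_iL_i^*v_i$ and $v_i\in(A_i\square D_i)(L_ix-r_i)$. Parameters: $\tau,\sigma_1,\dots,\sigma_n>0$, $\eta=\min\{\frac1\tau,\frac1{\sigma_1},\dots,\frac1{\sigma_n}\}\big(1-\sqrt{\tau\sum_i\sigma_i\omega_i\|L_i\|^2}\big)$, $\beta=\min\{\mu,\nu_1,\dots,\nu_n\}$, $2\eta\beta>1$, $\eta>0$, $\lambda_k\in(0,\frac{4\eta\beta-1}{2\eta\beta}]$; errors $\varepsilon_{1,k},\varepsilon_{2,k}\in\mathcal H$ and $\varepsilon_{3,i,k},\varepsilon_{4,i,k}\in\mathcal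 G_i$ are absolutely summable. Iteration ($J_M=(\mathrm{Id}+M)^{-1}$): $p_{k+1}=J_{\tau C}\big(x_k-\tau(\sum_i\omega_iL_i^*v_{i,k}+Bx_k+\varepsilon_{1,k})\big)+\varepsilon_{2,k}$; $y_{k+1}=2p_{k+1}-x_k$; $x_{k+1}=x_k+\lambda_k(p_{k+1}-x_k)$; and for $i=1,\dots,n$: $q_{i,k+1}=J_{\sigma_iA_i^{-1}}\big(v_{i,k}+\sigma_i(L_iy_{k+1}-D_i^{-1}v_{i,k}-\varepsilon_{3,i,k}-r_i)\big)+\varepsilon_{4,i,k}$; $v_{i,k+1}=v_{i,k}+\lambda_k(q_{i,k+1}-v_{i,k})$. Product form: $\boldsymbol{\mathcal G}=\mathcal G_1\times\dots\times\mathcal G_n$ with $\langle\boldsymbol v,\boldsymbol v'\rangle_{\boldsymbol{\mathcal G}}=\sum_i\omega_i\langle v_i,v_i'\rangle$; $\boldsymbol{\mathcal K}=\mathcal H\oplus\boldsymbol{\mathcal G}$ with $\langle(x,\boldsymbol v),(x',\boldsymbol v')\rangle_{\boldsymbol{\mathcal K}}=\langle x,x'\rangle+\langle\boldsymbol v,\boldsymbol v'\rangle_{\boldsymbol{\mathcal G}}$ and norm $\|\cdot\|_{\boldsymbol{\mathcal K}}$. Operators on $\boldsymbol{\mathcal K}$: $\boldsymbol C(x,\boldsymbol v)=(Cx)\times(r_1+A_1^{-1}v_1)\times\dots\times(r_n+A_n^{-1}v_n)$; $\boldsymbol D(x,\boldsymbol v)=(\sum_i\omega_iL_i^*v_i,-L_1x,\dots,-L_nx)$;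 $\boldsymbol E(x,\boldsymbol v)=(Bx,D_1^{-1}v_1,\dots,D_n^{-1}v_n)$; $\boldsymbol F(x,\boldsymbol v)=(\frac1\tau x-\sum_i\omega_iL_i^*v_i,\frac1{\sigma_1}v_1-L_1x,\dots,\frac1{\sigma_n}v_n-L_nx)$, which is self-adjoint and $\eta$-strongly positive. Put $\boldsymbol A=\boldsymbol F^{-1}(\boldsymbol C+\boldsymbol D)$, $\boldsymbol B=\boldsymbol F^{-1}\boldsymbol E$, $\boldsymbol z_k=(x_k,v_{1,k},\dots,v_{n,k})$, $\boldsymbol\varepsilon_{1,k}=(\varepsilon_{2,k},\varepsilon_{4,1,k},\dots,\varepsilon_{4,n,k})$, $\boldsymbol\varepsilon_{3,k}=(\varepsilon_{1,k},\varepsilon_{3,1,k},\dots,\varepsilon_{3,n,k})$, $\boldsymbol\varepsilon_{4,k}=(\frac1\tau\varepsilon_{2,k},\frac1{\sigma_1}\varepsilon_{4,1,k},\dots,\frac1{\sigma_n}\varepsilon_{4,n,k})$, $\boldsymbol\varepsilon_{2,k}=\boldsymbol F^{-1}\big((\boldsymbol D+\boldsymbol F)\boldsymbol\varepsilon_{1,k}+\boldsymbol\varepsilon_{3,k}-\boldsymbol\varepsilon_{4,k}\big)$. The iteration is then $\boldsymbol z_{k+1}=\boldsymbol z_k+\lambda_k\big(J_{\boldsymbol A}(\boldsymbol z_k-\boldsymbol B\boldsymbol z_k-\boldsymbol\varepsilon_{2,k})+\boldsymbol\varepsilon_{1,k}-\boldsymbol z_k\big)$. It is assumed that $\mathrm{fix}\,\boldsymbol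 T\neq\emptyset$. Further notation: $\boldsymbol\varepsilon_k=\big(J_{\boldsymbol A}(\boldsymbol z_k-\boldsymbol B\boldsymbol z_k-\boldsymbol\varepsilon_{2,k})+\boldsymbol\varepsilon_{1,k}\big)-J_{\boldsymbol A}(\boldsymbol z_k-\boldsymbol B\boldsymbol z_k)$; $\boldsymbol w_{k+1}=(\boldsymbol z_{k+1}-(1-\lambda_k)\boldsymbol z_k)/\lambda_k-\boldsymbol\varepsilon_k$; $\delta=\max\{\frac1\tau,\frac1{\sigma_1},\dots,\frac1{\sigma_n}\}$; $\underline\tau=\inf_k\lambda_k(\frac{4\eta\beta-1}{2\eta\beta}-\lambda_k)$; $d(0,S)=\inf_{s\in S}\|s\|_{\boldsymbol{\mathcal K}}$. *)

theory Defs
  imports "HOL-Analysis.Analysis" "HOL-Library.Set_Algebras"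
begin

text \<open>
  Set-valued operators are functions \<open>'a \<Rightarrow> 'a set\<close>. A Hilbert space is either a whole type of
  class \<open>real_inner\<close> and \<open>complete_space\<close>, or a closed linear subspace \<open>S\<close> of such a type. The
  latter is used for a finite family of possibly different Hilbert spaces: any such family is,
  up to isometry, a family of closed subspaces of one Hilbert space (its direct sum). An operator
  on \<open>S\<close> is one whose graph lies in \<open>S \<times> S\<close>.
\<close>

definition operator_on :: "'a set \<Rightarrow> ('a \<Rightarrow> 'a set) \<Rightarrow> bool" where
  "operator_on S M \<longleftrightarrow> (\<forall>x. \<forall>u\<in>M x. x \<in> S \<and> u \<in> S)"

definition monotone_operator :: "('a::real_inner \<Rightarrow> 'a set) \<Rightarrow> bool" where
  "monotone_operator M \<longleftrightarrow> (\<forall>x y. \<forall>u\<in>M x. \<forall>v\<in>M y. 0 \<le> (u - v) \<bullet> (x - y))"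

definition maximal_monotone_on :: "'a::real_inner set \<Rightarrow> ('a \<Rightarrow> 'a set) \<Rightarrow> bool" where
  "maximal_monotone_on S M \<longleftrightarrow>
     operator_on S M \<and> monotone_operator M \<and>
     (\<forall>N. operator_on S N \<and> monotone_operator N \<and> (\<forall>x. M x \<subseteq> N x) \<longrightarrow> N = M)"

definition strongly_monotone :: "real \<Rightarrow> ('a::real_inner \<Rightarrow> 'a set) \<Rightarrow> bool" where
  "strongly_monotone \<nu> M \<longleftrightarrow>
     (\<forall>x y. \<forall>u\<in>M x. \<forall>v\<in>M y. \<nu> * (norm (x - y))\<^sup>2 \<le> (u - v) \<bullet> (x - y))"

definition cocoercive :: "real \<Rightarrow> ('a::real_inner \<Rightarrow> 'a) \<Rightarrow> bool" where
  "cocoercive \<mu> B \<longleftrightarrow> (\<forall>x y. \<mu> * (norm (B x - B y))\<^sup>2 \<le> (B x - B y) \<bullet> (x - y))"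

definition inverse_op :: "('a \<Rightarrow> 'b set) \<Rightarrow> 'b \<Rightarrow> 'a set" where
  "inverse_op M u = {x. u \<in> M x}"

definition scale_op :: "real \<Rightarrow> ('a::real_vector \<Rightarrow> 'a set) \<Rightarrow> 'a \<Rightarrow> 'a set" where
  "scale_op t M x = (\<lambda>u. t *\<^sub>R u) ` M x"

text \<open>
  The value of the resolvent \<open>(Id + M)\<^sup>-\<^sup>1\<close> as a point. For \<open>M\<close> maximal monotone on a Hilbert
  space \<open>S\<close>, the set \<open>(Id + M)\<^sup>-\<^sup>1 z\<close> is a singleton for every \<open>z \<in> S\<close> (Minty); otherwise
  \<open>the_elem\<close> is unspecified.
\<close>

definition resolvent :: "('a::real_vector \<Rightarrow> 'a set) \<Rightarrow> 'a \<Rightarrow> 'a" where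
  "resolvent M z = the_elem (inverse_op (\<lambda>x. x +o M x) z)"

text \<open>
  The product space consists of the pairs \<open>(x, v)\<close> with \<open>v $ i \<in> G i\<close>. Its inner product is
  weighted by \<open>\<omega>\<close>, so it differs from the one that the types \<open>\<times>\<close> and \<open>^\<close> carry.
\<close>

definition K_space :: "('n::finite \<Rightarrow> 'g set) \<Rightarrow> ('h \<times> ('g ^ 'n)) set" where
  "K_space G = {(x, v). \<forall>i. v $ i \<in> G i}"

definition K_inner ::
  "('n::finite \<Rightarrow> real) \<Rightarrow> 'h::real_inner \<times> ('g::real_inner ^ 'n) \<Rightarrow> 'h \<times> ('g ^ 'n) \<Rightarrow> real" where
  "K_inner \<omega> z z' = fst z \<bullet> fst z' + (\<Sum>i\<in>UNIV. \<omega> i * (snd z $ i \<bullet> snd z' $ i))"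

definition K_norm :: "('n::finite \<Rightarrow> real) \<Rightarrow> 'h::real_inner \<times> ('g::real_inner ^ 'n) \<Rightarrow> real" where
  "K_norm \<omega> z = sqrt (K_inner \<omega> z z)"

text \<open>Extended-real valued, so that the distance to the empty set is infinite.\<close>

definition K_dist0 ::
  "('n::finite \<Rightarrow> real) \<Rightarrow> ('h::real_inner \<times> ('g::real_inner ^ 'n)) set \<Rightarrow> ereal" where
  "K_dist0 \<omega> S = (INF s\<in>S. ereal (K_norm \<omega> s))"

text \<open>
  \<open>adjoint (L i)\<close> is taken on the whole ambient type; for \<open>L i\<close> with range in \<open>G i\<close>, its
  restriction to \<open>G i\<close> is the adjoint of \<open>L i\<close> as an operator into \<open>G i\<close>.
\<close>

definition C_op ::
  "('h \<Rightarrow> 'h set) \<Rightarrow> ('n::finite \<Rightarrow> 'g \<Rightarrow> 'g set) \<Rightarrow> ('n \<Rightarrow> 'g)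
    \<Rightarrow> 'h \<times> ('g::real_inner ^ 'n) \<Rightarrow> ('h \<times> ('g ^ 'n)) set" where
  "C_op C A r = (\<lambda>(x, v). {(u, w). u \<in> C x \<and> (\<forall>i. w $ i \<in> r i +o inverse_op (A i) (v $ i))})"

definition D_op ::
  "('n::finite \<Rightarrow> real) \<Rightarrow> ('n \<Rightarrow> 'h \<Rightarrow> 'g)
    \<Rightarrow> 'h::real_inner \<times> ('g::real_inner ^ 'n) \<Rightarrow> 'h \<times> ('g ^ 'n)" where
  "D_op \<omega> L = (\<lambda>(x, v). (\<Sum>i\<in>UNIV. \<omega> i *\<^sub>R adjoint (L i) (v $ i), \<chi> i. - L i x))"

definition E_op ::
  "('h \<Rightarrow> 'h) \<Rightarrow> ('n::finite \<Rightarrow> 'g \<Rightarrow> 'g set) \<Rightarrow> 'h \<times> ('g ^ 'n) \<Rightarrow> 'h \<times> ('g ^ 'n)" where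
  "E_op B D = (\<lambda>(x, v). (B x, \<chi> i. the_elem (inverse_op (D i) (v $ i))))"

definition F_op ::
  "real \<Rightarrow> ('n::finite \<Rightarrow> real) \<Rightarrow> ('n \<Rightarrow> real) \<Rightarrow> ('n \<Rightarrow> 'h \<Rightarrow> 'g)
    \<Rightarrow> 'h::real_inner \<times> ('g::real_inner ^ 'n) \<Rightarrow> 'h \<times> ('g ^ 'n)" where
  "F_op \<tau> \<sigma> \<omega> L = (\<lambda>(x, v).
     ((1 / \<tau>) *\<^sub>R x - (\<Sum>i\<in>UNIV. \<omega> i *\<^sub>R adjoint (L i) (v $ i)),
      \<chi> i. (1 / \<sigma> i) *\<^sub>R (v $ i) - L i x))"

end

theory Submission
  imports Defs
begin

text \<open>
  The iteration is an inexact relaxed fixed-point iteration, and the estimate is the usual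
  \<open>O(1/\<surd>k)\<close> bound on its residual, read in the right geometry. The preconditioner \<open>F\<close> is
  self-adjoint and \<open>\<eta>\<close>-strongly positive (\<open>F_op_strongly_positive\<close>), so
  \<open>\<langle>F z, z'\<rangle>\<close> is an inner product. In it, \<open>A = F\<inverse>(C + D)\<close> is monotone, because \<open>C\<close> is monotone
  and \<open>D\<close> is skew, and \<open>B = F\<inverse>E\<close> is \<open>\<eta>\<beta>\<close>-cocoercive. Hence \<open>T = J\<^sub>A(Id - B)\<close> is averaged: with
  \<open>c = (4\<eta>\<beta> - 1)/(2\<eta>\<beta>)\<close>, the map \<open>N = c T - (c - 1) Id\<close> is nonexpansive (\<open>T_averaged\<close>). A step of
  \<open>T\<close> with relaxation \<open>\<lambda>\<close> is a step of \<open>N\<close> with relaxation \<open>\<lambda>/c\<close>, which the bounds on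
  \<open>\<lambda>\<^sub>k\<close> keep away from \<open>0\<close> and \<open>1\<close>.

  For such a step the squared distance to a fixed point drops by a multiple of the squared
  residual \<open>\<parallel>z\<^sub>k - N z\<^sub>k\<parallel>\<^sup>2\<close>, up to a summable error, so the squared residuals are summable. The
  residual itself grows by at most twice the current error in each step. Together with the summability
  of \<open>(k + 1)\<parallel>\<epsilon>\<^sub>k\<parallel>\<close>, this makes \<open>(k + 1)\<parallel>z\<^sub>k - N z\<^sub>k\<parallel>\<^sup>2\<close> bounded
  (\<open>inexact_krasnoselskii_mann_rate\<close>). Finally \<open>w\<^sub>k\<^sub>+\<^sub>1 = T z\<^sub>k\<close>, and
  \<open>(z\<^sub>k - w\<^sub>k\<^sub>+\<^sub>1) - (B z\<^sub>k - B w\<^sub>k\<^sub>+\<^sub>1)\<close> is an element of \<open>(A + B) w\<^sub>k\<^sub>+\<^sub>1\<close> whose norm is at most a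
  multiple of the residual (\<open>distance_le_residual\<close>). The constant \<open>C\<^sub>1\<close> may depend on all the data,
  so it can absorb the multiplicative constants.

  All of this presupposes that the resolvents, the inverses \<open>D\<^sub>i\<inverse>\<close> and the adjoints \<open>L\<^sub>i\<^sup>*\<close> exist as
  single points. These are the theorems of Minty and Riesz. Both are obtained here from one
  variational fact, \<open>convex_quadratic_minimizer\<close>: a functional \<open>t + \<parallel>c\<parallel>\<^sup>2\<close> that is bounded below on a
  convex set of pairs \<open>(c, t)\<close> has a minimizer in the closure, and its first-order optimality
  condition is the inequality that each theorem needs.
  The resolvent of \<open>A\<close> is not covered by Minty's theorem directly, but \<open>D + F\<close> is block lower
  triangular, so it is one sweep of the resolvents of \<open>C\<close> and of the \<open>A\<^sub>i\<inverse>\<close>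
  (\<open>resolvent_A_op\<close>). The same sweep is the given iteration step, which identifies the
  two forms of the iteration (\<open>splitting_step_eq_resolvent\<close>).
\<close>

section \<open>A variational principle and the theorems of Riesz and Minty\<close>

text \<open>
  Strong convexity in \<open>c\<close> makes minimizing sequences Cauchy, so completeness replaces
  weak compactness. The conclusion is the first-order optimality condition at the
  minimizer, weakened from the infimum to the lower bound \<open>s\<close>.
\<close>
lemma convex_quadratic_minimizer:
  fixes Q :: "('a::{real_inner, complete_space} \<times> real) set"
  assumes "convex Q" "Q \<noteq> {}" and bound: "\<And>c t. (c, t) \<in> Q \<Longrightarrow> s \<le> t + (norm c)\<^sup>2"
  obtains x where "x \<in> closure (fst ` Q)" "\<And>c t. (c, t) \<in> Q \<Longrightarrow> (norm x)\<^sup>2 + s \<le> t + 2 * (x \<bullet> c)"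
proof -
  define \<phi> where "\<phi> = (\<lambda>(c::'a, t::real). t + (norm c)\<^sup>2)"
  define m where "m = Inf (\<phi> ` Q)"
  have bdd: "bdd_below (\<phi> ` Q)"
    by (rule bdd_belowI[of _ s]) (auto simp: \<phi>_def bound)
  have m_le: "m \<le> t + (norm c)\<^sup>2" if "(c, t) \<in> Q" for c t
    using cINF_lower[OF bdd that] by (simp add: m_def \<phi>_def)
  have "s \<le> m"
    unfolding m_def by (rule cINF_greatest) (use assms in \<open>auto simp: \<phi>_def\<close>)
  define \<alpha> where "\<alpha> n = 1 / real (Suc n)" for n
  have "\<exists>p\<in>Q. \<phi> p < m + \<alpha> n" for n
  proof -
    have "m < m + \<alpha> n" by (simp add: \<alpha>_def)
    then show ?thesis
      unfolding m_def using cINF_less_iff[OF \<open>Q \<noteq> {}\<close> bdd] by blast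
  qed
  then obtain P where P: "\<And>n. P n \<in> Q" "\<And>n. \<phi> (P n) < m + \<alpha> n"
    by metis
  define c where "c n = fst (P n)" for n
  define t where "t n = snd (P n)" for n
  have ct: "(c n, t n) \<in> Q" "t n + (norm (c n))\<^sup>2 < m + \<alpha> n" for n
    using P[of n] by (simp_all add: c_def t_def \<phi>_def case_prod_beta)
  \<comment> \<open>The midpoint of two almost minimizers lies in \<open>Q\<close>; the parallelogram law bounds their distance.\<close>
  have close: "(norm (c i - c j))\<^sup>2 \<le> 2 * (\<alpha> i + \<alpha> j)" for i j
  proof -
    have "((1/2) *\<^sub>R c i + (1/2) *\<^sub>R c j, (1/2) *\<^sub>R t i + (1/2) *\<^sub>R t j) \<in> Q"
      using convexD[OF \<open>convex Q\<close> ct(1) ct(1), of "1/2" "1/2" i j] by simp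
    from m_le[OF this]
    have "m \<le> (t i + t j) / 2 + (norm ((1/2) *\<^sub>R c i + (1/2) *\<^sub>R c j))\<^sup>2"
      by (simp add: add_divide_distrib)
    also have "(norm ((1/2) *\<^sub>R c i + (1/2) *\<^sub>R c j))\<^sup>2
        = ((norm (c i))\<^sup>2 + (norm (c j))\<^sup>2) / 2 - (norm (c i - c j))\<^sup>2 / 4"
      unfolding power2_norm_eq_inner by (simp add: inner_simps inner_commute field_simps)
    finally show ?thesis using ct(2)[of i] ct(2)[of j] by (simp add: field_simps)
  qed
  have "Cauchy c"
  proof (rule metric_CauchyI)
    fix e :: real assume "e > 0"
    then have "e\<^sup>2 / 4 > 0" by simp
    then obtain M where M: "\<alpha> M < e\<^sup>2 / 4"
      using nat_approx_posE unfolding \<alpha>_def by blast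
    show "\<exists>M. \<forall>i\<ge>M. \<forall>j\<ge>M. dist (c i) (c j) < e"
    proof (intro exI allI impI)
      fix i j assume "M \<le> i" "M \<le> j"
      then have "\<alpha> i \<le> \<alpha> M" "\<alpha> j \<le> \<alpha> M"
        unfolding \<alpha>_def by (auto intro!: divide_left_mono)
      then have "(norm (c i - c j))\<^sup>2 < e\<^sup>2" using close[of i j] M by argo
      then show "dist (c i) (c j) < e"
        using \<open>e > 0\<close> by (simp add: dist_norm power2_less_imp_less)
    qed
  qed
  then obtain x where x: "c \<longlonglongrightarrow> x"
    using Cauchy_convergent_iff convergent_def by blast
  have t_lim: "t \<longlonglongrightarrow> m - (norm x)\<^sup>2"
  proof (rule real_tendsto_sandwich)
    show "\<forall>\<^sub>F n in sequentially. m - (norm (c n))\<^sup>2 \<le> t n"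
      using m_le[OF ct(1)] by (intro always_eventually) (auto simp: algebra_simps)
    show "\<forall>\<^sub>F n in sequentially. t n \<le> m + \<alpha> n - (norm (c n))\<^sup>2"
      using ct(2) by (intro always_eventually) (auto simp: algebra_simps intro: less_imp_le)
    show "(\<lambda>n. m - (norm (c n))\<^sup>2) \<longlonglongrightarrow> m - (norm x)\<^sup>2"
      by (intro tendsto_intros x)
    have "\<alpha> \<longlonglongrightarrow> 0"
      unfolding \<alpha>_def using LIMSEQ_Suc[OF lim_1_over_n[where 'a = real]] by simp
    then have "(\<lambda>n. m + \<alpha> n - (norm (c n))\<^sup>2) \<longlonglongrightarrow> m + 0 - (norm x)\<^sup>2"
      by (intro tendsto_intros x)
    then show "(\<lambda>n. m + \<alpha> n - (norm (c n))\<^sup>2) \<longlonglongrightarrow> m - (norm x)\<^sup>2" by simp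
  qed
  \<comment> \<open>Optimality is tested along the segment from the limit towards \<open>(a, b)\<close>, with \<open>g\<close> as the one-sided derivative.\<close>
  have "(norm x)\<^sup>2 + s \<le> b + 2 * (x \<bullet> a)" if ab: "(a, b) \<in> Q" for a b
  proof -
    define g where "g = b + 2 * (x \<bullet> a) - (norm x)\<^sup>2 - m"
    have ineq: "0 \<le> g + \<theta> * (norm (a - x))\<^sup>2" if \<theta>: "0 < \<theta>" "\<theta> < 1" for \<theta>
    proof -
      have "((1 - \<theta>) *\<^sub>R c n + \<theta> *\<^sub>R a, (1 - \<theta>) *\<^sub>R t n + \<theta> *\<^sub>R b) \<in> Q" for n
        using convexD[OF \<open>convex Q\<close> ct(1) ab, of "1 - \<theta>" \<theta> n] \<theta> by simp
      from m_le[OF this]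
      have "m \<le> (1 - \<theta>) * t n + \<theta> * b + (norm ((1 - \<theta>) *\<^sub>R c n + \<theta> *\<^sub>R a))\<^sup>2" for n
        by simp
      moreover have "(\<lambda>n. (1 - \<theta>) * t n + \<theta> * b + (norm ((1 - \<theta>) *\<^sub>R c n + \<theta> *\<^sub>R a))\<^sup>2)
          \<longlonglongrightarrow> (1 - \<theta>) * (m - (norm x)\<^sup>2) + \<theta> * b + (norm ((1 - \<theta>) *\<^sub>R x + \<theta> *\<^sub>R a))\<^sup>2"
        by (intro tendsto_intros x t_lim)
      ultimately have "m \<le> (1 - \<theta>) * (m - (norm x)\<^sup>2) + \<theta> * b
          + (norm ((1 - \<theta>) *\<^sub>R x + \<theta> *\<^sub>R a))\<^sup>2"
        by (intro LIMSEQ_le_const) auto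
      also have "(norm ((1 - \<theta>) *\<^sub>R x + \<theta> *\<^sub>R a))\<^sup>2
          = (1 - 2 * \<theta>) * (norm x)\<^sup>2 + 2 * \<theta> * (x \<bullet> a) + \<theta>\<^sup>2 * (norm (a - x))\<^sup>2"
        unfolding power2_norm_eq_inner
        by (simp add: inner_simps inner_commute algebra_simps power2_eq_square)
      finally have "0 \<le> \<theta> * (g + \<theta> * (norm (a - x))\<^sup>2)"
        by (simp add: g_def algebra_simps power2_eq_square)
      then show ?thesis using \<theta> by (simp add: zero_le_mult_iff)
    qed
    have "((\<lambda>\<theta>. g + \<theta> * (norm (a - x))\<^sup>2) \<longlongrightarrow> g + 0 * (norm (a - x))\<^sup>2) (at_right 0)"
      by (intro tendsto_intros)
    moreover have "\<forall>\<^sub>F \<theta> in at_right 0. 0 \<le> g + \<theta> * (norm (a - x))\<^sup>2"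
      using eventually_at_right_less[of 0] eventually_at_rightI[of 0 1]
      by (intro eventually_at_rightI[of 0 1]) (auto intro: ineq)
    ultimately have "0 \<le> g + 0 * (norm (a - x))\<^sup>2"
      by (rule tendsto_lowerbound) simp
    then show ?thesis using \<open>s \<le> m\<close> by (simp add: g_def)
  qed
  moreover have "x \<in> closure (fst ` Q)"
    unfolding closure_sequential using ct(1) x by (intro exI[of _ c]) force
  ultimately show thesis using that by blast
qed

text \<open>
  Riesz representation: on the graph of \<open>f\<close>, a subspace, the optimality condition bounds the linear functional
  \<open>f c + 2 (x \<bullet> c)\<close> from below, so this functional vanishes.
\<close>
lemma bounded_linear_functional_representation:
  fixes f :: "'a::{real_inner, complete_space} \<Rightarrow> real"
  assumes "bounded_linear f"
  obtains u where "\<And>x. f x = u \<bullet> x"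
proof -
  interpret f: bounded_linear f by fact
  define Q where "Q = range (\<lambda>c. (c, f c))"
  have "convex Q"
    unfolding convex_def Q_def by (auto simp: f.add f.scaleR intro!: image_eqI)
  moreover have "Q \<noteq> {}" by (simp add: Q_def)
  moreover obtain K where K: "\<And>x. norm (f x) \<le> norm x * K" using f.bounded by blast
  \<comment> \<open>The bound is the minimum of \<open>a\<^sup>2 - K a\<close> over all real \<open>a\<close>.\<close>
  have "- (K\<^sup>2) / 4 \<le> t + (norm c)\<^sup>2" if "(c, t) \<in> Q" for c t
  proof -
    have "- (norm c * K) \<le> t" using K[of c] that by (auto simp: Q_def)
    moreover have "0 \<le> (norm c - K / 2)\<^sup>2" by simp
    ultimately show ?thesis by (simp add: power2_diff power_divide)
  qed
  ultimately obtain x where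
    x: "\<And>c t. (c, t) \<in> Q \<Longrightarrow> (norm x)\<^sup>2 + - (K\<^sup>2) / 4 \<le> t + 2 * (x \<bullet> c)"
    using convex_quadratic_minimizer[of Q "- (K\<^sup>2) / 4"] by metis
  define l where "l c = f c + 2 * (x \<bullet> c)" for c
  define b where "b = (norm x)\<^sup>2 + - (K\<^sup>2) / 4"
  have lb: "b \<le> \<theta> * l c" for c \<theta>
  proof -
    have "(\<theta> *\<^sub>R c, f (\<theta> *\<^sub>R c)) \<in> Q" by (auto simp: Q_def)
    from x[OF this] show ?thesis by (simp add: l_def b_def f.scaleR algebra_simps)
  qed
  have "l c = 0" for c
  proof (rule ccontr)
    assume "l c \<noteq> 0"
    then show False using lb[of "(b - 1) / l c" c] by simp
  qed
  then have "f c = (- 2 *\<^sub>R x) \<bullet> c" for c by (simp add: l_def eq_neg_iff_add_eq_0)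
  then show thesis using that by blast
qed

lemma inner_adjoint:
  fixes f :: "'a::{real_inner, complete_space} \<Rightarrow> 'b::real_inner"
  assumes "bounded_linear f"
  shows "x \<bullet> adjoint f y = f x \<bullet> y"
proof -
  have "\<exists>u. \<forall>x. f x \<bullet> y = x \<bullet> u" for y
    using bounded_linear_functional_representation
      [OF bounded_linear_compose[OF bounded_linear_inner_left assms], of y]
    by (metis inner_commute)
  then have "\<exists>g. \<forall>x y. f x \<bullet> y = x \<bullet> g y" by metis
  then show ?thesis unfolding adjoint_def by (rule someI2_ex) simp
qed

text \<open>
  The core of Minty's theorem. The inequality for one pair \<open>(y, v)\<close> says that \<open>x\<close> lies in the ball with
  centre \<open>(y - v)/2\<close> and radius \<open>\<parallel>y + v\<parallel>/2\<close>, so the claim is that these balls have a common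
  point. The dual of this problem is a minimization over the convex hull of the triples
  \<open>(y, v, y \<bullet> v)\<close>. Monotonicity says that
  \<open>t + t' - y \<bullet> v' - y' \<bullet> v\<close> is nonnegative on pairs of such triples; as this expression is affine in each
  triple, it stays nonnegative on the hull, and on the diagonal it gives \<open>y \<bullet> v \<le> t\<close>. Since
  \<open>y \<bullet> v + \<parallel>(y - v)/2\<parallel>\<^sup>2 = \<parallel>(y + v)/2\<parallel>\<^sup>2\<close>, the dual objective is bounded below by \<open>0\<close>.
\<close>
lemma monotone_set_shifted_solution:
  fixes P :: "('a::{real_inner, complete_space} \<times> 'a) set"
  assumes S: "subspace S" "closed S" and PS: "P \<subseteq> S \<times> S" and "P \<noteq> {}"
    and mono: "\<And>y v y' v'. (y, v) \<in> P \<Longrightarrow> (y', v') \<in> P \<Longrightarrow> 0 \<le> (v - v') \<bullet> (y - y')"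
  obtains x where "x \<in> S" "\<And>y v. (y, v) \<in> P \<Longrightarrow> (x - y) \<bullet> (x + v) \<le> 0"
proof -
  define R where "R = (\<lambda>(y, v). (y, v, y \<bullet> v)) ` P"
  define bi where "bi = (\<lambda>(y::'a, v::'a, t::real) (y'::'a, v'::'a, t'::real).
      t + t' - y \<bullet> v' - y' \<bullet> v)"
  have bi_affine: "bi (a *\<^sub>R p + b *\<^sub>R p') q = a * bi p q + b * bi p' q"
    if "a + b = 1" for a b p p' q
  proof -
    have "b = 1 - a" using that by simp
    then show ?thesis
      unfolding \<open>b = 1 - a\<close> by (cases p, cases p', cases q) (simp add: bi_def inner_simps algebra_simps)
  qed
  have bi_sym: "bi p q = bi q p" for p q
    by (cases p, cases q) (simp add: bi_def algebra_simps)
  have conv: "convex {p. 0 \<le> bi p q}" for q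
    by (rule convexI) (simp add: bi_affine)
  have base: "0 \<le> bi p q" if "p \<in> R" "q \<in> R" for p q
    using that mono by (force simp: R_def bi_def inner_simps inner_commute)
  have hull_left: "convex hull R \<subseteq> {p. 0 \<le> bi p q}" if "q \<in> R" for q
    using base[OF _ that] by (intro hull_minimal conv subsetI CollectI)
  have half: "0 \<le> bi q p" if "p \<in> convex hull R" "q \<in> R" for p q
    using subsetD[OF hull_left[OF that(2)] that(1)] unfolding bi_sym[of q p] by simp
  have "convex hull R \<subseteq> {q. 0 \<le> bi q p}" if "p \<in> convex hull R" for p
    using half[OF that] by (intro hull_minimal conv subsetI CollectI)
  then have diag: "0 \<le> bi p p" if "p \<in> convex hull R" for p
    using that by (meson CollectD subsetD)
  define h where "h = (\<lambda>(y::'a, v::'a, t::real). ((1/2) *\<^sub>R (y - v), t))"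
  have "linear h"
    by (rule linearI) (auto simp: h_def algebra_simps)
  define Q where "Q = h ` (convex hull R)"
  have "convex Q" unfolding Q_def by (intro convex_linear_image \<open>linear h\<close> convex_convex_hull)
  moreover have "Q \<noteq> {}" using \<open>P \<noteq> {}\<close> by (simp add: Q_def R_def)
  moreover have "0 \<le> t + (norm c)\<^sup>2" if "(c, t) \<in> Q" for c t
  proof -
    obtain y v where yv: "(y, v, t) \<in> convex hull R" "c = (1/2) *\<^sub>R (y - v)"
      using \<open>(c, t) \<in> Q\<close> by (auto simp: Q_def h_def)
    then have "y \<bullet> v \<le> t" using diag[OF yv(1)] by (simp add: bi_def)
    moreover have "y \<bullet> v + (norm c)\<^sup>2 = (norm (y + v))\<^sup>2 / 4"
      unfolding yv(2) power2_norm_eq_inner by (simp add: inner_simps inner_commute field_simps)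
    moreover have "0 \<le> (norm (y + v))\<^sup>2 / 4" by simp
    ultimately show ?thesis by linarith
  qed
  ultimately obtain x where x: "x \<in> closure (fst ` Q)"
      "\<And>c t. (c, t) \<in> Q \<Longrightarrow> (norm x)\<^sup>2 + 0 \<le> t + 2 * (x \<bullet> c)"
    using convex_quadratic_minimizer[of Q 0] by metis
  have "R \<subseteq> S \<times> S \<times> UNIV" using PS by (auto simp: R_def)
  then have "convex hull R \<subseteq> S \<times> S \<times> UNIV"
    by (intro hull_minimal convex_Times subspace_imp_convex S convex_UNIV)
  then have "fst ` Q \<subseteq> S"
    using S(1) by (auto simp: Q_def h_def intro!: subspace_scale subspace_diff)
  then have "x \<in> S" using x(1) S(2) closure_minimal by blast
  moreover have "(x - y) \<bullet> (x + v) \<le> 0" if "(y, v) \<in> P" for y v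
  proof -
    have "(y, v, y \<bullet> v) \<in> convex hull R"
      using that by (intro hull_inc) (auto simp: R_def)
    then have "((1/2) *\<^sub>R (y - v), y \<bullet> v) \<in> Q"
      by (force simp: Q_def h_def)
    from x(2)[OF this] show ?thesis
      unfolding power2_norm_eq_inner by (simp add: inner_simps inner_commute algebra_simps)
  qed
  ultimately show thesis using that by blast
qed

lemma maximal_monotone_onD:
  assumes "maximal_monotone_on S M"
  shows "u \<in> M x \<Longrightarrow> x \<in> S" "u \<in> M x \<Longrightarrow> u \<in> S"
    "u \<in> M x \<Longrightarrow> v \<in> M y \<Longrightarrow> 0 \<le> (u - v) \<bullet> (x - y)"
  using assms unfolding maximal_monotone_on_def operator_on_def monotone_operator_def by blast+

text \<open>A pair related monotonically to the whole graph can be adjoined to it, so it belongs to it.\<close>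
lemma maximal_monotone_on_memI:
  assumes M: "maximal_monotone_on S M" and "x \<in> S" "u \<in> S"
    and rel: "\<And>y v. v \<in> M y \<Longrightarrow> 0 \<le> (u - v) \<bullet> (x - y)"
  shows "u \<in> M x"
proof -
  define N where "N y = M y \<union> (if y = x then {u} else {})" for y
  have "operator_on S N"
    using maximal_monotone_onD(1,2)[OF M] \<open>x \<in> S\<close> \<open>u \<in> S\<close>
    by (auto simp: operator_on_def N_def split: if_splits)
  moreover have "monotone_operator N"
    unfolding monotone_operator_def
  proof (intro allI ballI)
    fix a b c d assume "c \<in> N a" "d \<in> N b"
    moreover have "0 \<le> (c - u) \<bullet> (a - x)" if "c \<in> M a" for a c
      using rel[OF that] by (simp add: inner_simps algebra_simps)
    ultimately show "0 \<le> (c - d) \<bullet> (a - b)"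
      using maximal_monotone_onD(3)[OF M] rel by (auto simp: N_def split: if_splits)
  qed
  moreover have "\<forall>y. M y \<subseteq> N y" by (simp add: N_def)
  ultimately have "N = M" using M unfolding maximal_monotone_on_def by blast
  then show ?thesis by (metis N_def UnI2 singletonI)
qed

text \<open>
  Surjectivity of \<open>Id + t M\<close>. The shift \<open>v \<mapsto> t v - z\<close> turns the equation into the previous lemma,
  whose solution is monotonically related to the graph of \<open>M\<close>; maximality does the rest.
\<close>
theorem minty:
  fixes M :: "'a::{real_inner, complete_space} \<Rightarrow> 'a set"
  assumes S: "subspace S" "closed S" and M: "maximal_monotone_on S M"
    and "z \<in> S" "0 < t"
  obtains x u where "x \<in> S" "u \<in> M x" "x + t *\<^sub>R u = z"
proof -
  define P where "P = {(y, t *\<^sub>R v - z) | y v. v \<in> M y}"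
  have "P \<subseteq> S \<times> S"
    using maximal_monotone_onD(1,2)[OF M] S(1) \<open>z \<in> S\<close>
    by (auto simp: P_def intro!: subspace_scale subspace_diff)
  moreover have "P \<noteq> {}"
  proof
    assume "P = {}"
    then have "M y = {}" for y by (auto simp: P_def)
    moreover from this have "0 \<in> M 0"
      using maximal_monotone_on_memI[OF M subspace_0[OF S(1)] subspace_0[OF S(1)]] by blast
    ultimately show False by blast
  qed
  moreover have "0 \<le> (v - v') \<bullet> (y - y')" if "(y, v) \<in> P" "(y', v') \<in> P" for y v y' v'
  proof -
    obtain w w' where w: "w \<in> M y" "w' \<in> M y'" "v = t *\<^sub>R w - z" "v' = t *\<^sub>R w' - z"
      using \<open>(y, v) \<in> P\<close> \<open>(y', v') \<in> P\<close> unfolding P_def by blast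
    have "(v - v') \<bullet> (y - y') = t * ((w - w') \<bullet> (y - y'))"
      by (simp add: w inner_simps algebra_simps)
    then show ?thesis using maximal_monotone_onD(3)[OF M w(1,2)] \<open>0 < t\<close> by simp
  qed
  ultimately obtain x where x: "x \<in> S" "\<And>y v. (y, v) \<in> P \<Longrightarrow> (x - y) \<bullet> (x + v) \<le> 0"
    using monotone_set_shifted_solution[OF S, of P] by metis
  define u where "u = (1 / t) *\<^sub>R (z - x)"
  have "u \<in> M x"
  proof (rule maximal_monotone_on_memI[OF M \<open>x \<in> S\<close>])
    show "u \<in> S" unfolding u_def using S(1) x(1) \<open>z \<in> S\<close>
      by (intro subspace_scale subspace_diff)
    fix y v assume "v \<in> M y"
    then have "(x - y) \<bullet> (x + (t *\<^sub>R v - z)) \<le> 0" by (intro x(2)) (auto simp: P_def)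
    moreover have "x + (t *\<^sub>R v - z) = - (t *\<^sub>R (u - v))"
      using \<open>0 < t\<close> by (simp add: u_def algebra_simps)
    ultimately have "0 \<le> t * ((u - v) \<bullet> (x - y))" by (simp add: inner_commute)
    then show "0 \<le> (u - v) \<bullet> (x - y)" using \<open>0 < t\<close> by (simp add: zero_le_mult_iff)
  qed
  then show thesis using that[of x u] x(1) \<open>0 < t\<close> by (simp add: u_def)
qed

lemma maximal_monotone_on_inverse_op:
  assumes "maximal_monotone_on S M"
  shows "maximal_monotone_on S (inverse_op M)"
proof -
  have inv: "inverse_op (inverse_op N) = N" for N :: "'a \<Rightarrow> 'a set"
    by (auto simp: inverse_op_def)
  have op: "operator_on S (inverse_op N)" if "operator_on S N" for N
    using that by (auto simp: operator_on_def inverse_op_def)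
  have mo: "monotone_operator (inverse_op N)" if "monotone_operator N" for N :: "'a \<Rightarrow> 'a set"
    unfolding monotone_operator_def inverse_op_def mem_Collect_eq
  proof (intro allI ballI)
    fix x y u v assume "u \<in> {w. x \<in> N w}" "v \<in> {w. y \<in> N w}"
    then have "0 \<le> (x - y) \<bullet> (u - v)" using that unfolding monotone_operator_def by blast
    then show "0 \<le> (u - v) \<bullet> (x - y)" by (simp only: inner_commute)
  qed
  show ?thesis
    unfolding maximal_monotone_on_def
  proof (intro conjI allI impI)
    show "operator_on S (inverse_op M)" "monotone_operator (inverse_op M)"
      using assms op mo unfolding maximal_monotone_on_def by auto
    fix N assume N: "operator_on S N \<and> monotone_operator N \<and> (\<forall>x. inverse_op M x \<subseteq> N x)"
    have "\<forall>x. M x \<subseteq> inverse_op N x" using N by (auto simp: inverse_op_def)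
    moreover have "operator_on S (inverse_op N)" "monotone_operator (inverse_op N)"
      using N op mo by auto
    ultimately have "inverse_op N = M"
      using assms by (simp add: maximal_monotone_on_def)
    then show "N = inverse_op M" using inv by metis
  qed
qed

lemma resolvent_eqI:
  assumes "z - u \<in> M u" "\<And>u'. z - u' \<in> M u' \<Longrightarrow> u' = u"
  shows "resolvent M z = u"
proof -
  have "inverse_op (\<lambda>x. x +o M x) z = {x. z - x \<in> M x}"
    by (simp add: inverse_op_def set_minus_plus)
  also have "\<dots> = {u}" using assms by blast
  finally show ?thesis by (simp add: resolvent_def)
qed

lemma resolvent_scale_op:
  fixes M :: "'a::{real_inner, complete_space} \<Rightarrow> 'a set"
  assumes S: "subspace S" "closed S" and M: "maximal_monotone_on S M"
    and "z \<in> S" "0 < t"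
  shows "resolvent (scale_op t M) z \<in> S"
    and "(1 / t) *\<^sub>R (z - resolvent (scale_op t M) z) \<in> M (resolvent (scale_op t M) z)"
proof -
  obtain x u where xu: "x \<in> S" "u \<in> M x" "x + t *\<^sub>R u = z"
    using minty[OF assms] by metis
  have "resolvent (scale_op t M) z = x"
  proof (rule resolvent_eqI)
    show "z - x \<in> scale_op t M x" using xu by (auto simp: scale_op_def)
    fix x' assume "z - x' \<in> scale_op t M x'"
    then obtain u' where u': "u' \<in> M x'" "z - x' = t *\<^sub>R u'" by (auto simp: scale_op_def)
    have "t *\<^sub>R (u - u') = x' - x" using xu(3) u'(2) by (simp add: algebra_simps)
    then have "(x' - x) \<bullet> (x - x') = t * ((u - u') \<bullet> (x - x'))" by (metis inner_scaleR_left)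
    also have "\<dots> \<ge> 0" using maximal_monotone_onD(3)[OF M xu(2) u'(1)] \<open>0 < t\<close> by simp
    finally have "(x' - x) \<bullet> (x' - x) \<le> 0" by (simp add: inner_simps algebra_simps)
    then show "x' = x" by (metis eq_iff_diff_eq_0 inner_eq_zero_iff inner_ge_zero order_antisym)
  qed
  moreover have "(1 / t) *\<^sub>R (z - x) = u" using xu(3) \<open>0 < t\<close> by auto
  ultimately show "resolvent (scale_op t M) z \<in> S"
    "(1 / t) *\<^sub>R (z - resolvent (scale_op t M) z) \<in> M (resolvent (scale_op t M) z)"
    using xu by auto
qed

text \<open>
  Subtracting \<open>\<nu> Id\<close> leaves a maximal monotone operator, and \<open>M x \<ni> v\<close> becomes a resolvent equation for it;
  so existence is Minty's theorem.
\<close>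
lemma strongly_monotone_inverse_op_singleton:
  fixes M :: "'a::{real_inner, complete_space} \<Rightarrow> 'a set"
  assumes S: "subspace S" "closed S" and M: "maximal_monotone_on S M"
    and "0 < \<nu>" "strongly_monotone \<nu> M" "v \<in> S"
  obtains x where "inverse_op M v = {x}" "x \<in> S"
proof -
  define N where "N x = (\<lambda>u. u - \<nu> *\<^sub>R x) ` M x" for x
  have N_iff: "u \<in> N x \<longleftrightarrow> u + \<nu> *\<^sub>R x \<in> M x" for u x
    by (force simp: N_def)
  have "maximal_monotone_on S N"
    unfolding maximal_monotone_on_def
  proof (intro conjI allI impI)
    show "operator_on S N"
      using maximal_monotone_onD(1,2)[OF M] S(1)
      by (auto simp: operator_on_def N_def intro!: subspace_diff subspace_scale)
    show "monotone_operator N"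
      unfolding monotone_operator_def
    proof (intro allI ballI)
      fix x y u w assume "u \<in> N x" "w \<in> N y"
      then have "\<nu> * (norm (x - y))\<^sup>2 \<le> (u + \<nu> *\<^sub>R x - (w + \<nu> *\<^sub>R y)) \<bullet> (x - y)"
        using \<open>strongly_monotone \<nu> M\<close> unfolding strongly_monotone_def N_iff by blast
      then show "0 \<le> (u - w) \<bullet> (x - y)"
        by (simp add: power2_norm_eq_inner inner_simps algebra_simps)
    qed
    fix N' assume N': "operator_on S N' \<and> monotone_operator N' \<and> (\<forall>x. N x \<subseteq> N' x)"
    show "N' = N"
    proof (intro ext set_eqI iffI)
      fix x u assume "u \<in> N' x"
      have "u + \<nu> *\<^sub>R x \<in> M x"
      proof (rule maximal_monotone_on_memI[OF M])
        show "x \<in> S" "u + \<nu> *\<^sub>R x \<in> S"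
          using N' \<open>u \<in> N' x\<close> S(1) unfolding operator_on_def
          by (blast intro: subspace_add subspace_scale)+
        fix y w assume "w \<in> M y"
        then have "w - \<nu> *\<^sub>R y \<in> N y" by (simp add: N_iff)
        then have "w - \<nu> *\<^sub>R y \<in> N' y" using N' by blast
        then have "0 \<le> (u - (w - \<nu> *\<^sub>R y)) \<bullet> (x - y)"
          using N' \<open>u \<in> N' x\<close> unfolding monotone_operator_def by blast
        moreover have "(u + \<nu> *\<^sub>R x - w) \<bullet> (x - y)
            = (u - (w - \<nu> *\<^sub>R y)) \<bullet> (x - y) + \<nu> * ((x - y) \<bullet> (x - y))"
          by (simp add: inner_simps algebra_simps)
        ultimately show "0 \<le> (u + \<nu> *\<^sub>R x - w) \<bullet> (x - y)" using \<open>0 < \<nu>\<close> by simp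
      qed
      then show "u \<in> N x" by (simp add: N_iff)
    next
      fix x u assume "u \<in> N x" then show "u \<in> N' x" using N' by blast
    qed
  qed
  moreover have "(1 / \<nu>) *\<^sub>R v \<in> S" using S(1) \<open>v \<in> S\<close> by (rule subspace_scale)
  moreover have "0 < 1 / \<nu>" using \<open>0 < \<nu>\<close> by simp
  ultimately obtain x u where x: "x \<in> S" "u \<in> N x" "x + (1 / \<nu>) *\<^sub>R u = (1 / \<nu>) *\<^sub>R v"
    using minty[OF S] by metis
  have "u + \<nu> *\<^sub>R x = \<nu> *\<^sub>R (x + (1 / \<nu>) *\<^sub>R u)" using \<open>0 < \<nu>\<close> by (simp add: algebra_simps)
  also have "\<dots> = v" unfolding x(3) using \<open>0 < \<nu>\<close> by simp
  finally have v: "v \<in> M x" using x(2) by (simp add: N_iff)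
  have "y = x" if "v \<in> M y" for y
  proof -
    have "\<nu> * (norm (y - x))\<^sup>2 \<le> (v - v) \<bullet> (y - x)"
      using \<open>strongly_monotone \<nu> M\<close> that v unfolding strongly_monotone_def by blast
    then have "(norm (y - x))\<^sup>2 \<le> 0" using \<open>0 < \<nu>\<close> by (simp add: mult_le_0_iff)
    then show ?thesis by simp
  qed
  then have "inverse_op M v = {x}" using v unfolding inverse_op_def by blast
  then show thesis using that x(1) by blast
qed

section \<open>Averaged maps and the inexact Krasnoselskii--Mann iteration\<close>

text \<open>
  The product space carries two inner products at once, the weighted one and the one given by the
  preconditioner, and neither is that of its type. The forms are therefore parameters of a locale and not
  instances of a type class.
\<close>
locale semi_inner =
  fixes ip :: "'a::real_vector \<Rightarrow> 'a \<Rightarrow> real"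
  assumes ip_add_left: "ip (x + y) z = ip x z + ip y z"
    and ip_scaleR_left: "ip (a *\<^sub>R x) z = a * ip x z"
    and ip_commute: "ip x y = ip y x"
    and ip_nonneg: "0 \<le> ip x x"
begin

definition nrm :: "'a \<Rightarrow> real" where "nrm x = sqrt (ip x x)"

lemma ip_add_right: "ip z (x + y) = ip z x + ip z y"
  using ip_add_left ip_commute by metis

lemma ip_scaleR_right: "ip z (a *\<^sub>R x) = a * ip z x"
  using ip_scaleR_left ip_commute by metis

lemma ip_minus_left: "ip (- x) z = - ip x z"
  using ip_scaleR_left[of "-1" x z] by simp

lemma ip_diff_left: "ip (x - y) z = ip x z - ip y z"
  using ip_add_left[of x "- y" z] by (simp add: ip_minus_left)

lemma ip_diff_right: "ip z (x - y) = ip z x - ip z y"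
  using ip_diff_left ip_commute by metis

lemmas ip_simps = ip_add_left ip_add_right ip_diff_left ip_diff_right
  ip_scaleR_left ip_scaleR_right

lemma nrm_nonneg [simp]: "0 \<le> nrm x"
  by (simp add: nrm_def ip_nonneg)

lemma nrm_power2: "(nrm x)\<^sup>2 = ip x x"
  by (simp add: nrm_def ip_nonneg)

lemma nrm_scaleR: "nrm (a *\<^sub>R x) = \<bar>a\<bar> * nrm x"
  by (simp add: nrm_def ip_simps real_sqrt_mult flip: power2_eq_square mult.assoc)

text \<open>
  Cauchy--Schwarz for a form that may vanish on nonzero vectors: the usual optimal \<open>t\<close> in
  \<open>0 \<le> \<langle>x - t y, x - t y\<rangle>\<close> is unavailable when a norm is \<open>0\<close>, whence the cases.
\<close>
lemma ip_le_nrm_mult: "ip x y \<le> nrm x * nrm y"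
proof -
  have young: "2 * t * ip x y \<le> (nrm x)\<^sup>2 + t\<^sup>2 * (nrm y)\<^sup>2" for t
    unfolding nrm_power2 using ip_nonneg[of "x - t *\<^sub>R y"] ip_commute[of y x]
    by (simp add: ip_simps power2_eq_square algebra_simps)
  consider "nrm y = 0" | "nrm x = 0" "nrm y > 0" | "nrm x > 0" "nrm y > 0"
    using nrm_nonneg[of x] nrm_nonneg[of y] by linarith
  then show ?thesis
  proof cases
    case 1
    have "ip x y \<le> 0"
    proof (rule ccontr)
      assume "\<not> ip x y \<le> 0"
      then have "2 * ((nrm x)\<^sup>2 + 1) \<le> (nrm x)\<^sup>2"
        using young[of "((nrm x)\<^sup>2 + 1) / ip x y"] 1 by simp
      then show False using zero_le_power2[of "nrm x"] by argo
    qed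
    then show ?thesis using 1 by simp
  next
    case 2
    have "ip x y \<le> 0"
    proof (rule ccontr)
      assume "\<not> ip x y \<le> 0"
      then show False
        using young[of "ip x y / (nrm y)\<^sup>2"] 2 by (simp add: field_simps power2_eq_square)
    qed
    then show ?thesis using 2 by simp
  next
    case 3
    then show ?thesis
      using young[of "nrm x / nrm y"] by (simp add: field_simps power2_eq_square)
  qed
qed

lemma nrm_triangle: "nrm (x + y) \<le> nrm x + nrm y"
proof (rule power2_le_imp_le)
  show "(nrm (x + y))\<^sup>2 \<le> (nrm x + nrm y)\<^sup>2"
    using ip_le_nrm_mult[of x y] ip_commute[of y x]
    by (simp add: nrm_power2 ip_simps power2_sum)
qed simp

lemma nrm_triangle_diff: "nrm (x - y) \<le> nrm x + nrm y"
  using nrm_triangle[of x "(- 1) *\<^sub>R y"] nrm_scaleR[of "-1" y] by simp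

lemma nrm_convex_combination:
  "(nrm ((1 - \<theta>) *\<^sub>R x + \<theta> *\<^sub>R y))\<^sup>2
    = (1 - \<theta>) * (nrm x)\<^sup>2 + \<theta> * (nrm y)\<^sup>2 - \<theta> * (1 - \<theta>) * (nrm (x - y))\<^sup>2"
  unfolding nrm_power2 using ip_commute[of y x]
  by (simp add: ip_simps algebra_simps power2_eq_square)

text \<open>
  Here \<open>d\<close> is a difference of two points, \<open>b\<close> of their images under the forward operator, and \<open>e\<close> of the
  forward-backward images; \<open>mono\<close> is monotonicity of the backward operator. Expanding the claim
  reduces it to \<open>2\<parallel>e\<parallel>\<^sup>2 - 2\<langle>e, d\<rangle> \<le> \<parallel>d - e\<parallel>\<^sup>2/(2\<kappa>)\<close>. By \<open>mono\<close> and \<open>coco\<close> the left side is at most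
  \<open>2\<langle>d - e, b\<rangle> - 2\<kappa>\<parallel>b\<parallel>\<^sup>2\<close>, and Young's inequality finishes.
\<close>
lemma forward_backward_averaged:
  assumes \<kappa>: "1 < 2 * \<kappa>"
    and mono: "0 \<le> ip ((d - b) - e) e"
    and coco: "\<kappa> * (nrm b)\<^sup>2 \<le> ip b d"
  defines "c \<equiv> 2 - 1 / (2 * \<kappa>)"
  shows "nrm (c *\<^sub>R e - (c - 1) *\<^sub>R d) \<le> nrm d"
proof (rule power2_le_imp_le)
  define h where "h = 1 / (2 * \<kappa>)"
  have "0 < \<kappa>" "0 < h" "h < 1" "2 * \<kappa> * h = 1" using \<kappa> by (auto simp: h_def)
  have "0 \<le> h * (nrm ((d - e) - (2 * \<kappa>) *\<^sub>R b))\<^sup>2" using \<open>0 < h\<close> by simp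
  also have "\<dots> = h * (nrm (d - e))\<^sup>2 - (2 * \<kappa> * h) * (2 * ip (d - e) b)
      + (2 * \<kappa> * h) * (2 * \<kappa> * (nrm b)\<^sup>2)"
    unfolding nrm_power2 using ip_commute[of b d] ip_commute[of b e] ip_commute[of d e]
    by (simp add: ip_simps algebra_simps)
  finally have "2 * ip (d - e) b - 2 * \<kappa> * (nrm b)\<^sup>2 \<le> h * (nrm (d - e))\<^sup>2"
    unfolding \<open>2 * \<kappa> * h = 1\<close> by linarith
  then have "2 * ip e e - 2 * ip e d \<le> h * (nrm (d - e))\<^sup>2"
    using mono coco ip_commute[of b d] ip_commute[of b e] ip_commute[of d e]
    by (simp add: ip_simps)
  then have "0 \<le> c * (h * (nrm (d - e))\<^sup>2 - (2 * ip e e - 2 * ip e d))"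
    using \<open>h < 1\<close> by (simp add: c_def h_def[symmetric])
  also have "\<dots> = (nrm d)\<^sup>2 - (nrm (c *\<^sub>R e - (c - 1) *\<^sub>R d))\<^sup>2"
    unfolding nrm_power2 c_def h_def[symmetric] using ip_commute[of d e]
    by (simp add: ip_simps algebra_simps power2_eq_square)
  finally show "(nrm (c *\<^sub>R e - (c - 1) *\<^sub>R d))\<^sup>2 \<le> (nrm d)\<^sup>2" by linarith
qed simp

text \<open>
  Two estimates carry the proof: the squared distance to the fixed point decreases by a fixed
  multiple of the squared residual, and the residual is almost monotone. The first makes the squared
  residuals summable, the second lets the last residual be compared with their average. This
  comparison sums the errors once for every earlier index, which is why they carry the weight \<open>k + 1\<close>.
\<close>
theorem inexact_krasnoselskii_mann_rate:
  fixes N :: "'a \<Rightarrow> 'a" and z e :: "nat \<Rightarrow> 'a" and \<theta> :: "nat \<Rightarrow> real"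
  assumes nonexp: "\<And>u u'. u \<in> S \<Longrightarrow> u' \<in> S \<Longrightarrow> nrm (N u - N u') \<le> nrm (u - u')"
    and z_mem: "\<And>k. z k \<in> S"
    and fp: "zf \<in> S" "N zf = zf"
    and step: "\<And>k. z (Suc k) = z k + \<theta> k *\<^sub>R (N (z k) + e k - z k)"
    and \<theta>: "\<And>k. a \<le> \<theta> k" "\<And>k. \<theta> k \<le> b" and ab: "0 < a" "b < 1"
    and summ: "summable (\<lambda>k. real (k + 1) * nrm (e k))"
  shows "\<exists>M. \<forall>k. nrm (z k - N (z k)) \<le> M / sqrt (real (k + 1))"
proof -
  define \<epsilon> where "\<epsilon> k = nrm (e k)" for k
  define d where "d k = nrm (z k - zf)" for k
  define \<rho> where "\<rho> k = nrm (z k - N (z k))" for k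
  have [simp]: "0 \<le> \<epsilon> k" "0 \<le> d k" "0 \<le> \<rho> k" for k by (simp_all add: \<epsilon>_def d_def \<rho>_def)
  have \<theta>01: "0 < \<theta> k" "\<theta> k < 1" for k using \<theta>[of k] ab by linarith+
  define W where "W = (\<Sum>k. real (k + 1) * \<epsilon> k)"
  have weighted: "(\<Sum>j<k. real (j + 1) * \<epsilon> j) \<le> W" for k
    unfolding W_def using summ by (intro sum_le_suminf) (auto simp: \<epsilon>_def)
  have partial: "(\<Sum>j<k. \<epsilon> j) \<le> W" for k
  proof -
    have "(\<Sum>j<k. \<epsilon> j) \<le> (\<Sum>j<k. real (j + 1) * \<epsilon> j)"
      by (intro sum_mono) (simp add: distrib_right)
    then show ?thesis using weighted[of k] by linarith
  qed
  have \<epsilon>_le: "\<epsilon> k \<le> W" for k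
    using partial[of "Suc k"] sum_nonneg[of "{..<k}" \<epsilon>] by simp
  define R where "R = d 0 + W"
  have N_zf: "nrm (N (z k) - zf) \<le> d k" for k
    using nonexp[OF z_mem fp(1)] fp(2) by (simp add: d_def)
  \<comment> \<open>The distance to \<open>zf\<close> after an exact step; the identity for norms of convex combinations gives the descent.\<close>
  define m where "m k = nrm ((1 - \<theta> k) *\<^sub>R (z k - zf) + \<theta> k *\<^sub>R (N (z k) - zf))" for k
  have m_sq: "(m k)\<^sup>2 \<le> (d k)\<^sup>2 - \<theta> k * (1 - \<theta> k) * (\<rho> k)\<^sup>2" for k
  proof -
    have "\<theta> k * (nrm (N (z k) - zf))\<^sup>2 \<le> \<theta> k * (d k)\<^sup>2"
      using N_zf[of k] \<theta>01[of k] by (intro mult_left_mono power_mono) auto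
    then show ?thesis
      unfolding m_def nrm_convex_combination d_def \<rho>_def by (simp add: algebra_simps)
  qed
  have m_le: "m k \<le> d k" for k
  proof (rule power2_le_imp_le)
    have "0 \<le> \<theta> k * (1 - \<theta> k) * (\<rho> k)\<^sup>2" using \<theta>01[of k] by simp
    then show "(m k)\<^sup>2 \<le> (d k)\<^sup>2" using m_sq[of k] by linarith
  qed simp
  have \<theta>\<epsilon>: "\<theta> k * \<epsilon> k \<le> \<epsilon> k" for k
    using \<theta>01[of k] by (simp add: mult_left_le_one_le)
  have d_Suc: "d (Suc k) \<le> m k + \<epsilon> k" for k
  proof -
    have "z (Suc k) - zf
        = ((1 - \<theta> k) *\<^sub>R (z k - zf) + \<theta> k *\<^sub>R (N (z k) - zf)) + \<theta> k *\<^sub>R e k"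
      by (simp add: step algebra_simps)
    then have "d (Suc k) \<le> m k + nrm (\<theta> k *\<^sub>R e k)"
      unfolding d_def m_def using nrm_triangle by metis
    then show ?thesis using \<theta>\<epsilon>[of k] \<theta>01[of k] by (simp add: nrm_scaleR \<epsilon>_def)
  qed
  have "d k \<le> d 0 + (\<Sum>j<k. \<epsilon> j)" for k
  proof (induction k)
    case (Suc k)
    then show ?case using d_Suc[of k] m_le[of k] by simp
  qed simp
  then have d_le: "d k \<le> R" for k
    using partial[of k] unfolding R_def by (meson add_left_mono order_trans)
  have R: "0 \<le> W" "W \<le> R" "0 \<le> R"
    using \<epsilon>_le[of 0] d_le[of 0] by (auto simp: R_def intro: order_trans[of _ "\<epsilon> 0"])
  have \<epsilon>R: "\<epsilon> k * \<epsilon> k \<le> R * \<epsilon> k" for k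
    using \<epsilon>_le[of k] R by (intro mult_right_mono) auto
  have descent: "a * (1 - b) * (\<rho> k)\<^sup>2 \<le> (d k)\<^sup>2 - (d (Suc k))\<^sup>2 + 3 * R * \<epsilon> k" for k
  proof -
    have "(d (Suc k))\<^sup>2 \<le> (m k + \<epsilon> k)\<^sup>2"
      using d_Suc[of k] by (intro power_mono) auto
    also have "\<dots> = (m k)\<^sup>2 + 2 * (m k * \<epsilon> k) + \<epsilon> k * \<epsilon> k"
      by (simp add: power2_eq_square algebra_simps)
    also have "m k * \<epsilon> k \<le> R * \<epsilon> k"
      using m_le[of k] d_le[of k] by (intro mult_right_mono) auto
    finally have "(d (Suc k))\<^sup>2 \<le> (m k)\<^sup>2 + 3 * R * \<epsilon> k" using \<epsilon>R[of k] by linarith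
    moreover have "a * (1 - b) * (\<rho> k)\<^sup>2 \<le> \<theta> k * (1 - \<theta> k) * (\<rho> k)\<^sup>2"
      using \<theta>[of k] \<theta>01[of k] ab by (intro mult_right_mono mult_mono) auto
    ultimately show ?thesis using m_sq[of k] by linarith
  qed
  have "a * (1 - b) * (\<Sum>j<k. (\<rho> j)\<^sup>2) \<le> (d 0)\<^sup>2 - (d k)\<^sup>2 + 3 * R * (\<Sum>j<k. \<epsilon> j)" for k
  proof (induction k)
    case (Suc k)
    then show ?case using descent[of k] by (simp add: distrib_left)
  qed simp
  moreover have "3 * R * (\<Sum>j<k. \<epsilon> j) \<le> 3 * R * W" for k
    using partial R by (intro mult_left_mono) auto
  ultimately have "a * (1 - b) * (\<Sum>j<k. (\<rho> j)\<^sup>2) \<le> (d 0)\<^sup>2 + 3 * R * W" for k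
    by (smt (verit) zero_le_power2)
  then have sum_\<rho>: "(\<Sum>j<k. (\<rho> j)\<^sup>2) \<le> ((d 0)\<^sup>2 + 3 * R * W) / (a * (1 - b))" for k
    using ab by (simp add: field_simps)
  have \<rho>_le: "\<rho> k \<le> 2 * R" for k
  proof -
    have "z k - N (z k) = (z k - zf) - (N (z k) - zf)" by simp
    then have "\<rho> k \<le> d k + nrm (N (z k) - zf)"
      unfolding \<rho>_def d_def using nrm_triangle_diff by metis
    then show ?thesis using N_zf[of k] d_le[of k] by linarith
  qed
  have \<rho>_Suc: "\<rho> (Suc k) \<le> \<rho> k + 2 * \<epsilon> k" for k
  proof -
    have "z (Suc k) - N (z (Suc k))
        = ((1 - \<theta> k) *\<^sub>R (z k - N (z k)) + \<theta> k *\<^sub>R e k) - (N (z (Suc k)) - N (z k))"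
      by (simp add: step algebra_simps)
    then have "\<rho> (Suc k) \<le> nrm ((1 - \<theta> k) *\<^sub>R (z k - N (z k)) + \<theta> k *\<^sub>R e k)
        + nrm (N (z (Suc k)) - N (z k))"
      unfolding \<rho>_def using nrm_triangle_diff by metis
    also have "\<dots> \<le> nrm ((1 - \<theta> k) *\<^sub>R (z k - N (z k))) + nrm (\<theta> k *\<^sub>R e k)
        + nrm (z (Suc k) - z k)"
      using nonexp[OF z_mem z_mem] nrm_triangle by (intro add_mono) auto
    also have "z (Suc k) - z k = \<theta> k *\<^sub>R e k - \<theta> k *\<^sub>R (z k - N (z k))"
      by (simp add: step algebra_simps)
    also have "nrm \<dots> \<le> nrm (\<theta> k *\<^sub>R e k) + nrm (\<theta> k *\<^sub>R (z k - N (z k)))"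
      by (rule nrm_triangle_diff)
    finally have "\<rho> (Suc k) \<le> (1 - \<theta> k) * \<rho> k + \<theta> k * \<epsilon> k + (\<theta> k * \<epsilon> k + \<theta> k * \<rho> k)"
      using \<theta>01[of k] by (simp add: nrm_scaleR \<epsilon>_def \<rho>_def)
    then show ?thesis using \<theta>\<epsilon>[of k] by (simp add: algebra_simps)
  qed
  have \<rho>_sq_Suc: "(\<rho> (Suc k))\<^sup>2 \<le> (\<rho> k)\<^sup>2 + 12 * R * \<epsilon> k" for k
  proof -
    have "(\<rho> (Suc k))\<^sup>2 \<le> (\<rho> k + 2 * \<epsilon> k)\<^sup>2"
      using \<rho>_Suc[of k] by (intro power_mono) auto
    also have "\<dots> = (\<rho> k)\<^sup>2 + 4 * (\<rho> k * \<epsilon> k) + 4 * (\<epsilon> k * \<epsilon> k)"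
      by (simp add: power2_eq_square algebra_simps)
    also have "\<rho> k * \<epsilon> k \<le> 2 * R * \<epsilon> k" using \<rho>_le[of k] by (intro mult_right_mono) auto
    finally show ?thesis using \<epsilon>R[of k] by linarith
  qed
  define V where "V = ((d 0)\<^sup>2 + 3 * R * W) / (a * (1 - b)) + 12 * R * W"
  \<comment> \<open>Raising the weight from \<open>k + 1\<close> to \<open>k + 2\<close> costs one more squared residual.\<close>
  have "real (k + 1) * (\<rho> k)\<^sup>2
      \<le> (\<Sum>j<Suc k. (\<rho> j)\<^sup>2) + 12 * R * (\<Sum>j<k. real (j + 1) * \<epsilon> j)" for k
  proof (induction k)
    case (Suc k)
    have "real (k + 1) * (\<rho> (Suc k))\<^sup>2 \<le> real (k + 1) * ((\<rho> k)\<^sup>2 + 12 * R * \<epsilon> k)"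
      by (intro mult_left_mono \<rho>_sq_Suc) simp
    then show ?case using Suc by (simp add: algebra_simps)
  qed simp
  moreover have "12 * R * (\<Sum>j<k. real (j + 1) * \<epsilon> j) \<le> 12 * R * W" for k
    using weighted R by (intro mult_left_mono) auto
  ultimately have V: "real (k + 1) * (\<rho> k)\<^sup>2 \<le> V" for k
    unfolding V_def using sum_\<rho>[of "Suc k"] by (smt (verit))
  have "\<rho> k \<le> sqrt V / sqrt (real (k + 1))" for k
  proof -
    have "sqrt (real (k + 1) * (\<rho> k)\<^sup>2) \<le> sqrt V" using V by (rule real_sqrt_le_mono)
    then have "sqrt (real (k + 1)) * \<rho> k \<le> sqrt V" by (simp add: real_sqrt_mult)
    then show ?thesis by (simp add: pos_le_divide_eq mult.commute)
  qed
  then show ?thesis unfolding \<rho>_def by blast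
qed

end

section \<open>The preconditioned product space\<close>

lemma linear_adjoint:
  fixes f :: "'a::{real_inner, complete_space} \<Rightarrow> 'b::real_inner"
  assumes "bounded_linear f"
  shows "linear (adjoint f)"
  by (rule linearI) (simp_all add: vector_eq_ldot[symmetric] inner_adjoint[OF assms] inner_simps)

lemma norm_adjoint_le:
  fixes f :: "'a::{real_inner, complete_space} \<Rightarrow> 'b::real_inner"
  assumes "bounded_linear f"
  shows "norm (adjoint f y) \<le> onorm f * norm y"
proof (cases "adjoint f y = 0")
  case True
  then show ?thesis by (simp add: onorm_pos_le[OF assms])
next
  case False
  have "norm (adjoint f y) * norm (adjoint f y) = adjoint f y \<bullet> adjoint f y"
    by (simp flip: power2_norm_eq_inner power2_eq_square)
  also have "\<dots> = f (adjoint f y) \<bullet> y" by (rule inner_adjoint[OF assms])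
  also have "\<dots> \<le> norm (f (adjoint f y)) * norm y" by (rule norm_cauchy_schwarz)
  also have "\<dots> \<le> (onorm f * norm (adjoint f y)) * norm y"
    by (intro mult_right_mono onorm[OF assms]) simp
  finally have "norm (adjoint f y) * norm (adjoint f y) \<le> (onorm f * norm y) * norm (adjoint f y)"
    by (simp add: mult_ac)
  then show ?thesis using False by simp
qed

lemma weighted_sum_squares_le:
  fixes a :: real and b w :: "'i \<Rightarrow> real"
  assumes "0 \<le> a" "\<And>i. i \<in> I \<Longrightarrow> 0 \<le> b i" "\<alpha> \<le> m" "\<And>i. i \<in> I \<Longrightarrow> w i \<le> m" "0 \<le> m" "finite I"
  shows "\<alpha> * a\<^sup>2 + (\<Sum>i\<in>I. w i * (b i)\<^sup>2) \<le> m * (a + (\<Sum>i\<in>I. b i))\<^sup>2"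
proof -
  define S where "S = a + (\<Sum>i\<in>I. b i)"
  have S: "a \<le> S" "b i \<le> S" if "i \<in> I" for i
    using assms(1,2,6) member_le_sum[of i I b] that sum_nonneg[of I b] by (auto simp: S_def)
  have "a \<le> S" using assms sum_nonneg[of I b] by (simp add: S_def)
  have "\<alpha> * a\<^sup>2 \<le> m * (a * S)"
    unfolding power2_eq_square using assms \<open>a \<le> S\<close> by (intro mult_mono) auto
  moreover have "w i * (b i)\<^sup>2 \<le> m * (b i * S)" if "i \<in> I" for i
    unfolding power2_eq_square using assms S that by (intro mult_mono) auto
  then have "(\<Sum>i\<in>I. w i * (b i)\<^sup>2) \<le> (\<Sum>i\<in>I. m * (b i * S))" by (rule sum_mono)
  ultimately have "\<alpha> * a\<^sup>2 + (\<Sum>i\<in>I. w i * (b i)\<^sup>2) \<le> m * (a * S) + (\<Sum>i\<in>I. m * (b i * S))"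
    by linarith
  also have "\<dots> = m * (a * S) + m * ((\<Sum>i\<in>I. b i) * S)"
    by (simp only: sum_distrib_left sum_distrib_right)
  also have "\<dots> = m * S\<^sup>2" by (simp add: S_def power2_eq_square algebra_simps)
  finally show ?thesis by (simp add: S_def)
qed

locale primal_dual =
  fixes C :: "'h::{real_inner, complete_space} \<Rightarrow> 'h set"
    and B :: "'h \<Rightarrow> 'h"
    and G :: "'n::finite \<Rightarrow> 'g::{real_inner, complete_space} set"
    and A D :: "'n \<Rightarrow> 'g \<Rightarrow> 'g set"
    and L :: "'n \<Rightarrow> 'h \<Rightarrow> 'g"
    and r :: "'n \<Rightarrow> 'g"
    and \<mu> \<tau> \<eta> \<beta> :: real
    and \<omega> \<nu> \<sigma> :: "'n \<Rightarrow> real"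
  assumes G: "\<And>i. subspace (G i)" "\<And>i. closed (G i)"
    and C: "maximal_monotone_on UNIV C"
    and B: "\<mu> > 0" "cocoercive \<mu> B"
    and \<omega>: "\<And>i. 0 < \<omega> i \<and> \<omega> i < 1"
    and r: "\<And>i. r i \<in> G i"
    and A: "\<And>i. maximal_monotone_on (G i) (A i)"
    and D: "\<And>i. maximal_monotone_on (G i) (D i)" "\<And>i. \<nu> i > 0"
      "\<And>i. strongly_monotone (\<nu> i) (D i)"
    and L: "\<And>i. bounded_linear (L i)" "\<And>i. range (L i) \<subseteq> G i" "\<And>i. L i \<noteq> (\<lambda>_. 0)"
    and \<tau>\<sigma>: "\<tau> > 0" "\<And>i. \<sigma> i > 0"
    and \<eta>_def: "\<eta> = Min (insert (1 / \<tau>) (range (\<lambda>i. 1 / \<sigma> i)))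
                    * (1 - sqrt (\<tau> * (\<Sum>i\<in>UNIV. \<sigma> i * \<omega> i * (onorm (L i))\<^sup>2)))"
    and \<beta>_def: "\<beta> = Min (insert \<mu> (range \<nu>))"
    and \<eta>\<beta>: "2 * \<eta> * \<beta> > 1" "\<eta> > 0"
begin

abbreviation bC where "bC \<equiv> C_op C A r"
abbreviation bD where "bD \<equiv> D_op \<omega> L"
abbreviation bE where "bE \<equiv> E_op B D"
abbreviation bF where "bF \<equiv> F_op \<tau> \<sigma> \<omega> L"
abbreviation invF where "invF \<equiv> inv_into (K_space G) bF"
abbreviation bA where "bA \<equiv> \<lambda>u. invF ` (bD u +o bC u)"
abbreviation bB where "bB \<equiv> \<lambda>u. invF (bE u)"
abbreviation bT where "bT \<equiv> \<lambda>u. resolvent bA (u - bB u)"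

lemma \<omega>_pos [simp]: "0 < \<omega> i" "0 \<le> \<omega> i" using \<omega>[of i] by auto

lemma L_linear: "linear (L i)" using L(1) by (rule bounded_linear.linear)

lemma L_mem: "L i x \<in> G i" using L(2) by blast

lemmas G_closed = subspace_add[OF G(1)] subspace_diff[OF G(1)] subspace_scale[OF G(1)]
  subspace_neg[OF G(1)]

lemma adj_inner: "x \<bullet> adjoint (L i) y = L i x \<bullet> y" "adjoint (L i) y \<bullet> x = L i x \<bullet> y"
  using inner_adjoint[OF L(1)] by (simp_all add: inner_commute)

lemma K_space_iff: "u \<in> K_space G \<longleftrightarrow> (\<forall>i. snd u $ i \<in> G i)"
  by (simp add: K_space_def case_prod_beta)

lemma subspace_K_space: "subspace (K_space G)"
  using subspace_0[OF G(1)] by (auto simp: subspace_def K_space_iff intro: G_closed)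

lemmas K_closed = subspace_add[OF subspace_K_space] subspace_diff[OF subspace_K_space]
  subspace_scale[OF subspace_K_space]

lemma D_op_simps: "fst (bD u) = (\<Sum>i\<in>UNIV. \<omega> i *\<^sub>R adjoint (L i) (snd u $ i))"
  "snd (bD u) $ i = - L i (fst u)"
  by (simp_all add: D_op_def case_prod_beta)

lemma F_op_simps: "fst (bF u) = (1 / \<tau>) *\<^sub>R fst u - (\<Sum>i\<in>UNIV. \<omega> i *\<^sub>R adjoint (L i) (snd u $ i))"
  "snd (bF u) $ i = (1 / \<sigma> i) *\<^sub>R (snd u $ i) - L i (fst u)"
  by (simp_all add: F_op_def case_prod_beta)

lemma linear_D_op: "linear bD"
proof (rule linearI)
  fix u v :: "'h \<times> ('g ^ 'n)" and c
  show "bD (u + v) = bD u + bD v"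
    by (auto simp: prod_eq_iff vec_eq_iff D_op_simps linear_add[OF L_linear]
      linear_add[OF linear_adjoint[OF L(1)]] algebra_simps sum.distrib)
  show "bD (c *\<^sub>R u) = c *\<^sub>R bD u"
    by (auto simp: prod_eq_iff vec_eq_iff D_op_simps linear_scale[OF L_linear]
      linear_scale[OF linear_adjoint[OF L(1)]] scaleR_sum_right mult.commute)
qed

lemma linear_F_op: "linear bF"
proof (rule linearI)
  fix u v :: "'h \<times> ('g ^ 'n)" and c
  show "bF (u + v) = bF u + bF v"
    by (auto simp: prod_eq_iff vec_eq_iff F_op_simps linear_add[OF L_linear]
      linear_add[OF linear_adjoint[OF L(1)]] algebra_simps sum.distrib)
  show "bF (c *\<^sub>R u) = c *\<^sub>R bF u"
    by (auto simp: prod_eq_iff vec_eq_iff F_op_simps linear_scale[OF L_linear]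
      linear_scale[OF linear_adjoint[OF L(1)]] scaleR_sum_right algebra_simps)
qed

sublocale KI: semi_inner "K_inner \<omega> :: 'h \<times> ('g ^ 'n) \<Rightarrow> _"
  by unfold_locales
    (auto simp: K_inner_def inner_simps sum.distrib sum_distrib_left algebra_simps inner_commute
      intro!: add_nonneg_nonneg sum_nonneg mult_nonneg_nonneg)

lemma K_norm_eq: "K_norm \<omega> u = KI.nrm u" for u :: "'h \<times> ('g ^ 'n)"
  by (simp add: K_norm_def KI.nrm_def)

lemma K_inner_self: "K_inner \<omega> u u = (norm (fst u))\<^sup>2 + (\<Sum>i\<in>UNIV. \<omega> i * (norm (snd u $ i))\<^sup>2)"
  for u :: "'h \<times> ('g ^ 'n)"
  by (simp add: K_inner_def power2_norm_eq_inner)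

lemma K_inner_eq_0_imp:
  fixes u :: "'h \<times> ('g ^ 'n)"
  assumes "K_inner \<omega> u u \<le> 0"
  shows "u = 0"
proof -
  have nn: "0 \<le> (\<Sum>i\<in>UNIV. \<omega> i * (norm (snd u $ i))\<^sup>2)" by (intro sum_nonneg) simp
  then have "(\<Sum>i\<in>UNIV. \<omega> i * (norm (snd u $ i))\<^sup>2) = 0" "(norm (fst u))\<^sup>2 = 0"
    using assms zero_le_power2[of "norm (fst u)"] unfolding K_inner_self by linarith+
  then have "fst u = 0" "\<And>i. snd u $ i = 0"
    using less_imp_neq[OF \<omega>_pos(1)] by (auto simp: sum_nonneg_eq_0_iff)
  then show ?thesis by (simp add: prod_eq_iff vec_eq_iff)
qed

text \<open>
  The constant under which the off-diagonal part of the preconditioner is dominated by its diagonal part; \<open>\<eta> > 0\<close>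
  says that it is below \<open>1\<close>.
\<close>
definition coupling_ratio :: real where
  "coupling_ratio = sqrt (\<tau> * (\<Sum>i\<in>UNIV. \<sigma> i * \<omega> i * (onorm (L i))\<^sup>2))"

text \<open>The quadratic form of the diagonal part of the preconditioner.\<close>
definition diag_energy :: "'h \<times> ('g ^ 'n) \<Rightarrow> real" where
  "diag_energy u = (1 / \<tau>) * (norm (fst u))\<^sup>2 + (\<Sum>i\<in>UNIV. \<omega> i / \<sigma> i * (norm (snd u $ i))\<^sup>2)"

lemma coupling_ratio_power2: "coupling_ratio\<^sup>2 = \<tau> * (\<Sum>i\<in>UNIV. \<sigma> i * \<omega> i * (onorm (L i))\<^sup>2)"
  unfolding coupling_ratio_def using \<tau>\<sigma> by (intro real_sqrt_pow2 mult_nonneg_nonneg sum_nonneg) (auto simp: less_imp_le)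

lemma coupling_ratio_pos: "0 < coupling_ratio"
proof -
  have "0 < onorm (L i)" for i using onorm_pos_lt[OF L(1)] L(3) by (metis ext)
  then have "0 < (\<Sum>i\<in>UNIV. \<sigma> i * \<omega> i * (onorm (L i))\<^sup>2)"
    using \<tau>\<sigma> by (intro sum_pos mult_pos_pos zero_less_power) auto
  then show ?thesis unfolding coupling_ratio_def using \<tau>\<sigma> by simp
qed

lemma step_min_pos: "0 < Min (insert (1 / \<tau>) (range (\<lambda>i. 1 / \<sigma> i)))"
  using \<tau>\<sigma> by (subst Min_gr_iff) auto

lemma coupling_ratio_less_1: "coupling_ratio < 1"
proof -
  have "0 < Min (insert (1 / \<tau>) (range (\<lambda>i. 1 / \<sigma> i))) * (1 - coupling_ratio)"
    using \<eta>\<beta>(2) unfolding \<eta>_def coupling_ratio_def .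
  then have "0 < 1 - coupling_ratio" using step_min_pos by (rule zero_less_mult_pos)
  then show ?thesis by simp
qed

lemma diag_energy_nonneg: "0 \<le> diag_energy u"
  unfolding diag_energy_def using \<tau>\<sigma>
  by (intro add_nonneg_nonneg sum_nonneg mult_nonneg_nonneg divide_nonneg_nonneg) (auto simp: less_imp_le)

text \<open>
  Young's inequality for each index \<open>i\<close>, with weights chosen so that the coefficients of
  \<open>\<parallel>x\<parallel>\<^sup>2\<close> add up to exactly \<open>coupling_ratio / \<tau>\<close>.
\<close>
lemma coupling_le: "2 * \<bar>\<Sum>i\<in>UNIV. \<omega> i * (L i (fst u) \<bullet> snd u $ i)\<bar> \<le> coupling_ratio * diag_energy u"
proof -
  define x where "x = norm (fst u)"
  define v where "v i = norm (snd u $ i)" for i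
  have term_le: "2 * \<bar>\<omega> i * (L i (fst u) \<bullet> snd u $ i)\<bar>
      \<le> coupling_ratio * (\<omega> i / \<sigma> i * (v i)\<^sup>2) + \<sigma> i * \<omega> i * (onorm (L i))\<^sup>2 * (x\<^sup>2 / coupling_ratio)" for i
  proof -
    define b where "b = onorm (L i) * x"
    have "\<bar>L i (fst u) \<bullet> snd u $ i\<bar> \<le> norm (L i (fst u)) * v i"
      unfolding v_def by (rule Cauchy_Schwarz_ineq2)
    also have "\<dots> \<le> b * v i"
      unfolding b_def x_def by (intro mult_right_mono onorm[OF L(1)]) (simp add: v_def)
    finally have 1: "\<bar>L i (fst u) \<bullet> snd u $ i\<bar> \<le> b * v i" .
    have "0 \<le> (coupling_ratio * v i - \<sigma> i * b)\<^sup>2 / (coupling_ratio * \<sigma> i)" using coupling_ratio_pos \<tau>\<sigma>(2)[of i] by simp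
    also have "\<dots> = coupling_ratio / \<sigma> i * (v i)\<^sup>2 + \<sigma> i / coupling_ratio * b\<^sup>2 - 2 * (b * v i)"
      using coupling_ratio_pos \<tau>\<sigma>(2)[of i] by (simp add: power2_eq_square field_simps)
    finally have "2 * \<bar>L i (fst u) \<bullet> snd u $ i\<bar> \<le> coupling_ratio / \<sigma> i * (v i)\<^sup>2 + \<sigma> i / coupling_ratio * b\<^sup>2"
      using 1 by linarith
    then have "\<omega> i * (2 * \<bar>L i (fst u) \<bullet> snd u $ i\<bar>)
        \<le> \<omega> i * (coupling_ratio / \<sigma> i * (v i)\<^sup>2 + \<sigma> i / coupling_ratio * b\<^sup>2)"
      by (rule mult_left_mono) simp
    then show ?thesis by (simp add: abs_mult b_def power_mult_distrib algebra_simps)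
  qed
  have "2 * \<bar>\<Sum>i\<in>UNIV. \<omega> i * (L i (fst u) \<bullet> snd u $ i)\<bar>
      \<le> 2 * (\<Sum>i\<in>UNIV. \<bar>\<omega> i * (L i (fst u) \<bullet> snd u $ i)\<bar>)"
    using sum_abs by (intro mult_left_mono) auto
  also have "\<dots> \<le> (\<Sum>i\<in>UNIV. coupling_ratio * (\<omega> i / \<sigma> i * (v i)\<^sup>2) + \<sigma> i * \<omega> i * (onorm (L i))\<^sup>2 * (x\<^sup>2 / coupling_ratio))"
    unfolding sum_distrib_left by (intro sum_mono term_le)
  also have "\<dots> = coupling_ratio * (\<Sum>i\<in>UNIV. \<omega> i / \<sigma> i * (v i)\<^sup>2)
      + (\<Sum>i\<in>UNIV. \<sigma> i * \<omega> i * (onorm (L i))\<^sup>2) * (x\<^sup>2 / coupling_ratio)"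
    by (simp only: sum.distrib sum_distrib_left sum_distrib_right)
  also have "(\<Sum>i\<in>UNIV. \<sigma> i * \<omega> i * (onorm (L i))\<^sup>2) = coupling_ratio\<^sup>2 / \<tau>"
    unfolding coupling_ratio_power2 using \<tau>\<sigma> by simp
  also have "coupling_ratio * (\<Sum>i\<in>UNIV. \<omega> i / \<sigma> i * (v i)\<^sup>2) + coupling_ratio\<^sup>2 / \<tau> * (x\<^sup>2 / coupling_ratio) = coupling_ratio * diag_energy u"
    using coupling_ratio_pos unfolding diag_energy_def x_def v_def
    by (simp add: power2_eq_square distrib_left)
  finally show ?thesis .
qed

lemma K_inner_F_op: "K_inner \<omega> (bF u) u' = (1 / \<tau>) * (fst u \<bullet> fst u')
    + (\<Sum>i\<in>UNIV. \<omega> i / \<sigma> i * (snd u $ i \<bullet> snd u' $ i))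
    - (\<Sum>i\<in>UNIV. \<omega> i * (L i (fst u') \<bullet> snd u $ i))
    - (\<Sum>i\<in>UNIV. \<omega> i * (L i (fst u) \<bullet> snd u' $ i))"
  by (simp add: K_inner_def F_op_simps inner_diff_left inner_sum_left adj_inner
      right_diff_distrib sum_subtractf)

lemma K_inner_F_op_self: "K_inner \<omega> (bF u) u
    = diag_energy u - 2 * (\<Sum>i\<in>UNIV. \<omega> i * (L i (fst u) \<bullet> snd u $ i))"
  by (simp add: K_inner_F_op diag_energy_def power2_norm_eq_inner)

lemma F_op_strongly_positive: "\<eta> * K_inner \<omega> u u \<le> K_inner \<omega> (bF u) u"
proof -
  define m where "m = Min (insert (1 / \<tau>) (range (\<lambda>i. 1 / \<sigma> i)))"
  have m: "m \<le> 1 / \<tau>" "m \<le> 1 / \<sigma> i" for i unfolding m_def by (intro Min_le; simp)+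
  have "m * (\<omega> i * (norm (snd u $ i))\<^sup>2) \<le> \<omega> i / \<sigma> i * (norm (snd u $ i))\<^sup>2" for i
    using mult_right_mono[OF m(2)[of i], of "\<omega> i * (norm (snd u $ i))\<^sup>2"] by simp
  then have "m * K_inner \<omega> u u \<le> diag_energy u"
    unfolding K_inner_self diag_energy_def distrib_left sum_distrib_left
    by (intro add_mono mult_right_mono m sum_mono) auto
  then have "(1 - coupling_ratio) * (m * K_inner \<omega> u u) \<le> (1 - coupling_ratio) * diag_energy u"
    using coupling_ratio_less_1 by (intro mult_left_mono) auto
  also have "\<dots> \<le> K_inner \<omega> (bF u) u"
    using coupling_le[of u] unfolding K_inner_F_op_self by (simp add: algebra_simps)
  also have "(1 - coupling_ratio) * (m * K_inner \<omega> u u) = \<eta> * K_inner \<omega> u u"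
    by (simp add: \<eta>_def coupling_ratio_def m_def)
  finally show ?thesis .
qed

sublocale FI: semi_inner "\<lambda>u u'. K_inner \<omega> (bF u) u'"
proof
  fix x y z :: "'h \<times> ('g ^ 'n)" and a
  show "K_inner \<omega> (bF (x + y)) z = K_inner \<omega> (bF x) z + K_inner \<omega> (bF y) z"
    by (simp add: linear_add[OF linear_F_op] KI.ip_simps)
  show "K_inner \<omega> (bF (a *\<^sub>R x)) z = a * K_inner \<omega> (bF x) z"
    by (simp add: linear_scale[OF linear_F_op] KI.ip_simps)
  show "K_inner \<omega> (bF x) y = K_inner \<omega> (bF y) x"
    by (simp add: K_inner_F_op inner_commute)
  have "0 \<le> \<eta> * K_inner \<omega> x x" using \<eta>\<beta>(2) KI.ip_nonneg by simp
  then show "0 \<le> K_inner \<omega> (bF x) x" using F_op_strongly_positive[of x] by linarith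
qed

lemma KI_nrm_le_FI_nrm: "sqrt \<eta> * KI.nrm u \<le> FI.nrm u"
  unfolding KI.nrm_def FI.nrm_def real_sqrt_mult[symmetric]
  by (intro real_sqrt_le_mono F_op_strongly_positive)

lemma F_op_mem: "u \<in> K_space G \<Longrightarrow> bF u \<in> K_space G"
  by (auto simp: K_space_iff F_op_simps intro: G_closed L_mem)

lemma F_op_inj: "bF u = bF u' \<Longrightarrow> u = u'"
proof -
  assume "bF u = bF u'"
  then have "bF (u - u') = 0" by (simp add: linear_diff[OF linear_F_op])
  then have "K_inner \<omega> (bF (u - u')) (u - u') = 0" by (simp add: K_inner_def)
  then have "K_inner \<omega> (u - u') (u - u') \<le> 0"
    using F_op_strongly_positive[of "u - u'"] \<eta>\<beta>(2) by (simp add: mult_le_0_iff)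
  then show "u = u'" using K_inner_eq_0_imp by fastforce
qed

text \<open>
  Eliminating the dual variables from \<open>F u = f\<close> leaves a fixed-point equation for the primal one. Its
  linear part is \<open>\<tau> \<Sum>\<^sub>i \<omega>\<^sub>i \<sigma>\<^sub>i L\<^sub>i\<^sup>* L\<^sub>i\<close>, a contraction with factor
  \<open>coupling_ratio\<^sup>2\<close>.
\<close>
lemma F_op_surj:
  assumes "f \<in> K_space G"
  shows "\<exists>u\<in>K_space G. bF u = f"
proof -
  obtain a b where f: "f = (a, b)" "\<And>i. b $ i \<in> G i"
    using assms by (cases f) (auto simp: K_space_iff)
  define w where "w x i = \<sigma> i *\<^sub>R (b $ i + L i x)" for x i
  \<comment> \<open>\<open>w x\<close> solves the dual rows for given \<open>x\<close>, and \<open>\<Phi> x = x\<close> is then the primal row.\<close>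
  define \<Phi> where "\<Phi> x = \<tau> *\<^sub>R (a + (\<Sum>i\<in>UNIV. \<omega> i *\<^sub>R adjoint (L i) (w x i)))" for x
  have "norm (\<Phi> x - \<Phi> y) \<le> coupling_ratio\<^sup>2 * norm (x - y)" for x y
  proof -
    have w: "w x i - w y i = \<sigma> i *\<^sub>R L i (x - y)" for i
      by (simp add: w_def linear_diff[OF L_linear] algebra_simps)
    have "\<Phi> x - \<Phi> y = \<tau> *\<^sub>R (\<Sum>i\<in>UNIV. \<omega> i *\<^sub>R adjoint (L i) (w x i - w y i))"
      by (simp add: \<Phi>_def linear_diff[OF linear_adjoint[OF L(1)]] scaleR_diff_right sum_subtractf
        algebra_simps)
    then have "norm (\<Phi> x - \<Phi> y) \<le> \<tau> * (\<Sum>i\<in>UNIV. norm (\<omega> i *\<^sub>R adjoint (L i) (w x i - w y i)))"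
      using \<tau>\<sigma>(1) norm_sum[of "\<lambda>i. \<omega> i *\<^sub>R adjoint (L i) (w x i - w y i)" UNIV]
      by (simp only: norm_scaleR abs_of_pos) (intro mult_left_mono, auto)
    also have "\<dots> \<le> \<tau> * (\<Sum>i\<in>UNIV. \<sigma> i * \<omega> i * (onorm (L i))\<^sup>2 * norm (x - y))"
    proof (intro mult_left_mono sum_mono)
      fix i
      have "norm (adjoint (L i) (w x i - w y i)) \<le> onorm (L i) * (\<sigma> i * norm (L i (x - y)))"
        using norm_adjoint_le[OF L(1), of i "w x i - w y i"] \<tau>\<sigma>(2)[of i] unfolding w by simp
      also have "\<dots> \<le> onorm (L i) * (\<sigma> i * (onorm (L i) * norm (x - y)))"
        using \<tau>\<sigma>(2)[of i] by (intro mult_left_mono onorm[OF L(1)] onorm_pos_le[OF L(1)]) auto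
      finally have "\<omega> i * norm (adjoint (L i) (w x i - w y i))
          \<le> \<omega> i * (onorm (L i) * (\<sigma> i * (onorm (L i) * norm (x - y))))"
        by (rule mult_left_mono) simp
      then show "norm (\<omega> i *\<^sub>R adjoint (L i) (w x i - w y i))
          \<le> \<sigma> i * \<omega> i * (onorm (L i))\<^sup>2 * norm (x - y)"
        by (simp add: power2_eq_square mult_ac)
    qed (use \<tau>\<sigma>(1) in simp)
    also have "\<dots> = coupling_ratio\<^sup>2 * norm (x - y)" unfolding coupling_ratio_power2 by (simp add: sum_distrib_right)
    finally show ?thesis .
  qed
  moreover have "coupling_ratio\<^sup>2 < 1" using coupling_ratio_pos coupling_ratio_less_1 by (simp add: power_less_one_iff)
  ultimately obtain x where x: "\<Phi> x = x"
    using banach_fix_type[of "coupling_ratio\<^sup>2" \<Phi>] by (auto simp: dist_norm)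
  have "bF (x, \<chi> i. w x i) = f"
  proof -
    have "(1 / \<tau>) *\<^sub>R x = a + (\<Sum>i\<in>UNIV. \<omega> i *\<^sub>R adjoint (L i) (w x i))"
      using arg_cong[OF x[symmetric], of "scaleR (1 / \<tau>)"] \<tau>\<sigma>(1) by (simp add: \<Phi>_def)
    moreover have "(1 / \<sigma> i) *\<^sub>R w x i = b $ i + L i x" for i
      using \<tau>\<sigma>(2)[of i] by (simp add: w_def)
    ultimately show ?thesis by (simp add: f(1) prod_eq_iff vec_eq_iff F_op_simps)
  qed
  moreover have "(x, \<chi> i. w x i) \<in> K_space G"
    using f(2) by (auto simp: K_space_iff w_def intro!: G_closed L_mem)
  ultimately show ?thesis by blast
qed

lemma invF_mem: "f \<in> K_space G \<Longrightarrow> invF f \<in> K_space G"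
  using F_op_surj[of f] by (intro inv_into_into) auto

lemma F_op_invF: "f \<in> K_space G \<Longrightarrow> bF (invF f) = f"
  using F_op_surj[of f] by (intro f_inv_into_f) auto

lemma invF_F_op: "u \<in> K_space G \<Longrightarrow> invF (bF u) = u"
  using F_op_inj by (intro inv_into_f_f inj_onI) auto

text \<open>
  With \<open>F b = f\<close>, strong positivity \<open>\<eta>\<parallel>b\<parallel>\<^sup>2 \<le> \<langle>f, b\<rangle>\<close> in the expansion of
  \<open>0 \<le> \<parallel>f - \<eta> b\<parallel>\<^sup>2\<close> gives \<open>\<eta>\<langle>f, b\<rangle> \<le> \<parallel>f\<parallel>\<^sup>2\<close>, and \<open>\<langle>f, b\<rangle>\<close> is the squared preconditioned
  norm of \<open>b\<close>.
\<close>
lemma FI_nrm_invF_le: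
  assumes "f \<in> K_space G"
  shows "sqrt \<eta> * FI.nrm (invF f) \<le> KI.nrm f"
proof -
  define b where "b = invF f"
  have f: "bF b = f" using F_op_invF[OF assms] by (simp add: b_def)
  have "\<eta> * (FI.nrm b)\<^sup>2 \<le> (KI.nrm f)\<^sup>2"
  proof -
    have "0 \<le> K_inner \<omega> (f - \<eta> *\<^sub>R b) (f - \<eta> *\<^sub>R b)" by (rule KI.ip_nonneg)
    also have "\<dots> = (KI.nrm f)\<^sup>2 - 2 * \<eta> * K_inner \<omega> f b + \<eta> * (\<eta> * K_inner \<omega> b b)"
      unfolding KI.nrm_power2 using KI.ip_commute[of b f]
      by (simp add: KI.ip_simps algebra_simps)
    also have "\<eta> * (\<eta> * K_inner \<omega> b b) \<le> \<eta> * K_inner \<omega> f b"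
      using F_op_strongly_positive[of b] \<eta>\<beta>(2) unfolding f by (intro mult_left_mono) auto
    finally show ?thesis unfolding FI.nrm_power2 f by simp
  qed
  then have "sqrt (\<eta> * (FI.nrm b)\<^sup>2) \<le> sqrt ((KI.nrm f)\<^sup>2)" by (rule real_sqrt_le_mono)
  then show ?thesis by (simp add: real_sqrt_mult b_def)
qed

text \<open>
  A norm in which the summability of the error components can be used one component at a time.
\<close>
definition total_norm :: "'h \<times> ('g ^ 'n) \<Rightarrow> real" where
  "total_norm u = norm (fst u) + (\<Sum>i\<in>UNIV. norm (snd u $ i))"

lemma total_norm_nonneg: "0 \<le> total_norm u"
  unfolding total_norm_def by (intro add_nonneg_nonneg sum_nonneg) auto

lemma KI_nrm_le_total_norm: "KI.nrm u \<le> total_norm u"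
proof (rule power2_le_imp_le)
  show "(KI.nrm u)\<^sup>2 \<le> (total_norm u)\<^sup>2"
    unfolding KI.nrm_power2 K_inner_self total_norm_def
    using weighted_sum_squares_le[of "norm (fst u)" UNIV "\<lambda>i. norm (snd u $ i)" 1 1 \<omega>] \<omega>
    by (auto simp: less_imp_le)
qed (rule total_norm_nonneg)

lemma FI_nrm_le_total_norm: "\<exists>c. \<forall>u. FI.nrm u \<le> c * total_norm u"
proof -
  define m where "m = Max (insert (1 / \<tau>) (range (\<lambda>i. \<omega> i / \<sigma> i)))"
  have m: "1 / \<tau> \<le> m" "\<omega> i / \<sigma> i \<le> m" for i unfolding m_def by (intro Max_ge; simp)+
  have "0 \<le> m" using m(1) \<tau>\<sigma>(1) by (meson divide_pos_pos less_imp_le order_trans zero_less_one)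
  have "FI.nrm u \<le> sqrt (2 * m) * total_norm u" for u
  proof (rule power2_le_imp_le)
    have "coupling_ratio * diag_energy u \<le> 1 * diag_energy u"
      using coupling_ratio_less_1 diag_energy_nonneg by (intro mult_right_mono) auto
    then have "(FI.nrm u)\<^sup>2 \<le> 2 * diag_energy u"
      using coupling_le[of u] unfolding FI.nrm_power2 K_inner_F_op_self by linarith
    also have "diag_energy u \<le> m * (total_norm u)\<^sup>2"
      unfolding diag_energy_def total_norm_def
      using m \<open>0 \<le> m\<close> by (intro weighted_sum_squares_le) auto
    finally show "(FI.nrm u)\<^sup>2 \<le> (sqrt (2 * m) * total_norm u)\<^sup>2"
      using \<open>0 \<le> m\<close> by (simp add: power_mult_distrib)
  qed (use \<open>0 \<le> m\<close> total_norm_nonneg in simp)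
  then show ?thesis by blast
qed

section \<open>The forward and backward operators\<close>

lemma D_op_mem: "bD u \<in> K_space G"
  by (auto simp: K_space_iff D_op_simps intro: G_closed L_mem)

lemma K_inner_D_op_self: "K_inner \<omega> (bD u) u = 0"
  by (simp add: K_inner_def D_op_simps inner_sum_left adj_inner sum_negf)

lemma E_op_simps: "fst (bE u) = B (fst u)" "snd (bE u) $ i = the_elem (inverse_op (D i) (snd u $ i))"
  by (simp_all add: E_op_def case_prod_beta)

lemma inverse_D:
  assumes "v \<in> G i"
  shows "the_elem (inverse_op (D i) v) \<in> G i" "v \<in> D i (the_elem (inverse_op (D i) v))"
proof -
  obtain x where x: "inverse_op (D i) v = {x}" "x \<in> G i"
    using strongly_monotone_inverse_op_singleton[OF G(1,2) D(1) D(2) D(3) assms] by blast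
  have "v \<in> D i x" using x(1) unfolding inverse_op_def by blast
  then show "the_elem (inverse_op (D i) v) \<in> G i" "v \<in> D i (the_elem (inverse_op (D i) v))"
    using x by simp_all
qed

lemma E_op_mem: "u \<in> K_space G \<Longrightarrow> bE u \<in> K_space G"
  by (simp add: K_space_iff E_op_simps inverse_D)

lemma \<beta>_le: "\<beta> \<le> \<mu>" "\<beta> \<le> \<nu> i"
  unfolding \<beta>_def by (intro Min_le; simp)+

lemma \<beta>_pos: "0 < \<beta>"
proof -
  have "0 < (2 * \<eta>) * \<beta>" using \<eta>\<beta>(1) by linarith
  moreover have "0 < 2 * \<eta>" using \<eta>\<beta>(2) by simp
  ultimately show ?thesis by (rule zero_less_mult_pos)
qed

text \<open>
  Strong monotonicity of \<open>D\<^sub>i\<close> is cocoercivity of \<open>D\<^sub>i\<inverse>\<close> with the same constant, and \<open>\<beta>\<close> is the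
  smallest of the constants.
\<close>
lemma E_op_cocoercive:
  assumes "u \<in> K_space G" "u' \<in> K_space G"
  shows "\<beta> * (KI.nrm (bE u - bE u'))\<^sup>2 \<le> K_inner \<omega> (bE u - bE u') (u - u')"
proof -
  have "\<beta> * (norm (B (fst u) - B (fst u')))\<^sup>2 \<le> \<mu> * (norm (B (fst u) - B (fst u')))\<^sup>2"
    by (intro mult_right_mono \<beta>_le) simp
  also have "\<dots> \<le> (B (fst u) - B (fst u')) \<bullet> (fst u - fst u')"
    using B(2) by (simp add: cocoercive_def)
  finally have primal: "\<beta> * (norm (B (fst u) - B (fst u')))\<^sup>2
      \<le> (B (fst u) - B (fst u')) \<bullet> (fst u - fst u')" .
  define y where "y = snd (bE u)"
  define y' where "y' = snd (bE u')"
  have dual: "\<beta> * (\<omega> i * (norm (y $ i - y' $ i))\<^sup>2)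
      \<le> \<omega> i * ((y $ i - y' $ i) \<bullet> (snd u $ i - snd u' $ i))" for i
  proof -
    have "\<beta> * (norm (y $ i - y' $ i))\<^sup>2 \<le> \<nu> i * (norm (y $ i - y' $ i))\<^sup>2"
      by (intro mult_right_mono \<beta>_le) simp
    also have "\<dots> \<le> (snd u $ i - snd u' $ i) \<bullet> (y $ i - y' $ i)"
      using D(3)[of i] inverse_D(2) assms
      unfolding strongly_monotone_def y_def y'_def E_op_simps K_space_iff by blast
    finally have "\<omega> i * (\<beta> * (norm (y $ i - y' $ i))\<^sup>2)
        \<le> \<omega> i * ((y $ i - y' $ i) \<bullet> (snd u $ i - snd u' $ i))"
      by (intro mult_left_mono) (simp_all add: inner_commute)
    then show ?thesis by (simp add: mult.left_commute)
  qed
  have "\<beta> * (\<Sum>i\<in>UNIV. \<omega> i * (norm (y $ i - y' $ i))\<^sup>2)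
      \<le> (\<Sum>i\<in>UNIV. \<omega> i * ((y $ i - y' $ i) \<bullet> (snd u $ i - snd u' $ i)))"
    unfolding sum_distrib_left by (intro sum_mono dual)
  then show ?thesis
    using primal unfolding KI.nrm_power2 K_inner_self unfolding K_inner_def
    by (simp add: E_op_simps(1) y_def y'_def distrib_left)
qed

lemma B_op_mem: "u \<in> K_space G \<Longrightarrow> bB u \<in> K_space G"
  by (intro invF_mem E_op_mem)

lemma F_op_B_op: "u \<in> K_space G \<Longrightarrow> bF (bB u) = bE u"
  by (intro F_op_invF E_op_mem)

text \<open>
  The preconditioned product of \<open>F\<inverse>e\<close> with \<open>u - u'\<close> is \<open>\<langle>e, u - u'\<rangle>\<close>, while passing from \<open>\<parallel>e\<parallel>\<close> to the
  preconditioned norm of \<open>F\<inverse>e\<close> costs the factor \<open>\<eta>\<close>.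
\<close>
lemma B_op_cocoercive:
  assumes "u \<in> K_space G" "u' \<in> K_space G"
  shows "(\<eta> * \<beta>) * (FI.nrm (bB u - bB u'))\<^sup>2 \<le> K_inner \<omega> (bF (bB u - bB u')) (u - u')"
proof -
  define e where "e = bE u - bE u'"
  have b: "bF (bB u - bB u') = e"
    using assms by (simp add: linear_diff[OF linear_F_op] F_op_B_op e_def)
  have e: "e \<in> K_space G" unfolding e_def using assms by (intro K_closed E_op_mem)
  have "bB u - bB u' = invF e"
    using invF_F_op[of "bB u - bB u'"] assms by (simp add: b K_closed B_op_mem)
  then have "sqrt \<eta> * FI.nrm (bB u - bB u') \<le> KI.nrm e"
    using FI_nrm_invF_le[OF e] by simp
  then have "(sqrt \<eta> * FI.nrm (bB u - bB u'))\<^sup>2 \<le> (KI.nrm e)\<^sup>2"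
    using \<eta>\<beta>(2) by (intro power_mono) auto
  then have "\<beta> * (\<eta> * (FI.nrm (bB u - bB u'))\<^sup>2) \<le> \<beta> * (KI.nrm e)\<^sup>2"
    using \<eta>\<beta>(2) \<beta>_pos by (intro mult_left_mono) (auto simp: power_mult_distrib)
  also have "\<dots> \<le> K_inner \<omega> e (u - u')" unfolding e_def by (rule E_op_cocoercive[OF assms])
  finally show ?thesis unfolding b by (simp add: mult_ac)
qed

lemma C_op_iff: "w \<in> bC u \<longleftrightarrow> fst w \<in> C (fst u) \<and> (\<forall>i. snd w $ i - r i \<in> inverse_op (A i) (snd u $ i))"
  unfolding C_op_def case_prod_beta mem_Collect_eq set_minus_plus by simp

lemmas inverse_A = maximal_monotone_on_inverse_op[OF A]

lemma C_op_mem: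
  assumes "w \<in> bC u"
  shows "u \<in> K_space G" "w \<in> K_space G"
proof -
  have w: "snd w $ i - r i \<in> inverse_op (A i) (snd u $ i)" for i using assms by (simp add: C_op_iff)
  show "u \<in> K_space G"
    unfolding K_space_iff using maximal_monotone_onD(1)[OF inverse_A w] by blast
  have "(snd w $ i - r i) + r i \<in> G i" for i
    by (rule subspace_add[OF G(1) maximal_monotone_onD(2)[OF inverse_A w] r])
  then show "w \<in> K_space G" by (simp add: K_space_iff)
qed

lemma C_op_monotone:
  assumes "w \<in> bC u" "w' \<in> bC u'"
  shows "0 \<le> K_inner \<omega> (w - w') (u - u')"
proof -
  have "0 \<le> ((snd w $ i - r i) - (snd w' $ i - r i)) \<bullet> (snd u $ i - snd u' $ i)" for i
    using assms unfolding C_op_iff by (blast intro: maximal_monotone_onD(3)[OF inverse_A])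
  then have "0 \<le> (\<Sum>i\<in>UNIV. \<omega> i * ((snd w $ i - snd w' $ i) \<bullet> (snd u $ i - snd u' $ i)))"
    by (intro sum_nonneg mult_nonneg_nonneg) auto
  moreover have "0 \<le> (fst w - fst w') \<bullet> (fst u - fst u')"
    using assms unfolding C_op_iff by (blast intro: maximal_monotone_onD(3)[OF C])
  ultimately show ?thesis by (simp add: K_inner_def)
qed

text \<open>
  The solution of \<open>g \<in> (C + D + F) u\<close>. In \<open>D + F\<close> the dual variables cancel from the primal row, and
  the dual rows contain \<open>- 2 L\<^sub>i x\<close>; so the primal unknown is found first and then inserted into
  each dual equation.
\<close>
definition sweep :: "'h \<times> ('g ^ 'n) \<Rightarrow> 'h \<times> ('g ^ 'n)" where
  "sweep g = (let p = resolvent (scale_op \<tau> C) (\<tau> *\<^sub>R fst g) in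
     (p, \<chi> i. resolvent (scale_op (\<sigma> i) (inverse_op (A i)))
                (\<sigma> i *\<^sub>R (snd g $ i + 2 *\<^sub>R L i p - r i))))"

lemma sweep_solves:
  assumes "g \<in> K_space G"
  shows "g - bF (sweep g) - bD (sweep g) \<in> bC (sweep g)"
proof -
  define p where "p = resolvent (scale_op \<tau> C) (\<tau> *\<^sub>R fst g)"
  define b where "b i = \<sigma> i *\<^sub>R (snd g $ i + 2 *\<^sub>R L i p - r i)" for i
  define q where "q i = resolvent (scale_op (\<sigma> i) (inverse_op (A i))) (b i)" for i
  have sweep: "sweep g = (p, \<chi> i. q i)" by (simp add: sweep_def Let_def p_def q_def b_def)
  have "b i \<in> G i" for i
    using assms r unfolding b_def by (intro G_closed L_mem) (auto simp: K_space_iff)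
  then have "(1 / \<sigma> i) *\<^sub>R (b i - q i) \<in> inverse_op (A i) (q i)" for i
    unfolding q_def using resolvent_scale_op(2)[OF G inverse_A] \<tau>\<sigma>(2) by blast
  moreover have "(1 / \<sigma> i) *\<^sub>R (b i - q i) = snd (g - bF (sweep g) - bD (sweep g)) $ i - r i" for i
    using \<tau>\<sigma>(2)[of i] by (simp add: b_def sweep F_op_simps D_op_simps scaleR_2 algebra_simps)
  moreover have "(1 / \<tau>) *\<^sub>R (\<tau> *\<^sub>R fst g - p) \<in> C p"
    unfolding p_def using \<tau>\<sigma>(1) by (intro resolvent_scale_op(2)[OF subspace_UNIV closed_UNIV C]) auto
  moreover have "(1 / \<tau>) *\<^sub>R (\<tau> *\<^sub>R fst g - p) = fst (g - bF (sweep g) - bD (sweep g))"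
    using \<tau>\<sigma>(1) by (simp add: sweep F_op_simps D_op_simps algebra_simps)
  ultimately show ?thesis
    unfolding C_op_iff by (simp only: sweep fst_conv snd_conv vec_lambda_beta simp_thms)
qed

text \<open>
  Removes the inverse of \<open>F\<close> from the inclusion. This inverse is taken on the product of the \<open>G\<^sub>i\<close>, which
  contains \<open>z\<close> as well as the domain and the range of \<open>C\<close>.
\<close>
lemma A_op_iff:
  assumes "z \<in> K_space G"
  shows "z - u \<in> bA u \<longleftrightarrow> bF z - bF u - bD u \<in> bC u"
proof
  assume "z - u \<in> bA u"
  then obtain f where f: "f \<in> bD u +o bC u" "z - u = invF f" by blast
  have C: "f - bD u \<in> bC u" using f(1) unfolding set_minus_plus .
  have "f - bD u + bD u \<in> K_space G" using C_op_mem(2)[OF C] D_op_mem by (rule K_closed)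
  then have "bF (z - u) = f" unfolding f(2) by (intro F_op_invF) simp
  then show "bF z - bF u - bD u \<in> bC u" using C by (simp add: linear_diff[OF linear_F_op])
next
  assume C: "bF z - bF u - bD u \<in> bC u"
  then have "bF z - bF u \<in> bD u +o bC u" by (simp only: set_minus_plus)
  moreover have "z - u = invF (bF z - bF u)"
    using invF_F_op[of "z - u"] K_closed(2)[OF assms C_op_mem(1)[OF C]]
    by (simp add: linear_diff[OF linear_F_op])
  ultimately show "z - u \<in> bA u" by blast
qed

text \<open>The skew part \<open>D\<close> drops out of the monotonicity inequality.\<close>
lemma C_D_F_monotone:
  assumes "g - bF u - bD u \<in> bC u" "g' - bF u' - bD u' \<in> bC u'"
  shows "0 \<le> K_inner \<omega> (g - g' - bF (u - u')) (u - u')"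
proof -
  have "0 \<le> K_inner \<omega> ((g - bF u - bD u) - (g' - bF u' - bD u')) (u - u')"
    by (rule C_op_monotone[OF assms])
  also have "(g - bF u - bD u) - (g' - bF u' - bD u') = (g - g' - bF (u - u')) - bD (u - u')"
    by (simp add: linear_diff[OF linear_F_op] linear_diff[OF linear_D_op])
  finally show ?thesis by (simp add: KI.ip_diff_left K_inner_D_op_self)
qed

lemma resolvent_A_op:
  assumes "z \<in> K_space G"
  shows "resolvent bA z = sweep (bF z)"
proof (rule resolvent_eqI)
  have sw: "bF z - bF (sweep (bF z)) - bD (sweep (bF z)) \<in> bC (sweep (bF z))"
    by (intro sweep_solves F_op_mem assms)
  then show "z - sweep (bF z) \<in> bA (sweep (bF z))" by (simp only: A_op_iff[OF assms])
  fix u assume "z - u \<in> bA u"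
  then have "bF z - bF u - bD u \<in> bC u" by (simp only: A_op_iff[OF assms])
  from C_D_F_monotone[OF this sw]
  have "FI.nrm (u - sweep (bF z)) ^ 2 \<le> 0"
    unfolding FI.nrm_power2 using KI.ip_diff_left[of 0] by (simp add: KI.ip_minus_left)
  then have "sqrt \<eta> * KI.nrm (u - sweep (bF z)) \<le> 0"
    using KI_nrm_le_FI_nrm[of "u - sweep (bF z)"] by simp
  then have "KI.nrm (u - sweep (bF z)) = 0"
    using \<eta>\<beta>(2) KI.nrm_nonneg[of "u - sweep (bF z)"] by (simp add: mult_le_0_iff)
  then have "K_inner \<omega> (u - sweep (bF z)) (u - sweep (bF z)) \<le> 0"
    using KI.nrm_power2[of "u - sweep (bF z)"] by simp
  from K_inner_eq_0_imp[OF this] show "u = sweep (bF z)" by simp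
qed

lemma resolvent_A_op_in:
  assumes "z \<in> K_space G"
  shows "z - resolvent bA z \<in> bA (resolvent bA z)"
  unfolding A_op_iff[OF assms] unfolding resolvent_A_op[OF assms]
  by (intro sweep_solves F_op_mem assms)

lemma resolvent_A_op_mem:
  assumes "z \<in> K_space G"
  shows "resolvent bA z \<in> K_space G"
  using C_op_mem(1) resolvent_A_op_in[OF assms] unfolding A_op_iff[OF assms] .

lemma resolvent_A_op_monotone:
  assumes "z \<in> K_space G" "z' \<in> K_space G"
  shows "0 \<le> K_inner \<omega> (bF ((z - z') - (resolvent bA z - resolvent bA z')))
    (resolvent bA z - resolvent bA z')"
  using C_D_F_monotone[OF resolvent_A_op_in[OF assms(1), unfolded A_op_iff[OF assms(1)]]
      resolvent_A_op_in[OF assms(2), unfolded A_op_iff[OF assms(2)]]]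
  by (simp add: linear_diff[OF linear_F_op])

lemma resolvent_A_op_nonexpansive:
  assumes "z \<in> K_space G" "z' \<in> K_space G"
  shows "FI.nrm (resolvent bA z - resolvent bA z') \<le> FI.nrm (z - z')"
proof -
  define e where "e = resolvent bA z - resolvent bA z'"
  have "FI.nrm e * FI.nrm e \<le> K_inner \<omega> (bF (z - z')) e"
    using resolvent_A_op_monotone[OF assms] FI.nrm_power2[of e]
    by (simp add: e_def[symmetric] FI.ip_diff_left power2_eq_square)
  also have "\<dots> \<le> FI.nrm (z - z') * FI.nrm e" by (rule FI.ip_le_nrm_mult)
  finally have "FI.nrm e * FI.nrm e \<le> FI.nrm (z - z') * FI.nrm e" .
  then show ?thesis
    using FI.nrm_nonneg[of e] FI.nrm_nonneg[of "z - z'"]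
    unfolding e_def[symmetric] by (cases "FI.nrm e = 0") auto
qed

section \<open>The rate for the preconditioned fixed-point iteration\<close>

definition lam_bound :: real where "lam_bound = (4 * \<eta> * \<beta> - 1) / (2 * \<eta> * \<beta>)"

lemma lam_bound_eq: "lam_bound = 2 - 1 / (2 * (\<eta> * \<beta>))"
  unfolding lam_bound_def using \<eta>\<beta>(2) \<beta>_pos by (simp add: field_simps)

lemma lam_bound_pos: "0 < lam_bound"
  unfolding lam_bound_def using \<eta>\<beta> \<beta>_pos by (intro divide_pos_pos) auto

lemma T_averaged:
  assumes "u \<in> K_space G" "u' \<in> K_space G"
  shows "FI.nrm ((lam_bound *\<^sub>R bT u - (lam_bound - 1) *\<^sub>R u) - (lam_bound *\<^sub>R bT u' - (lam_bound - 1) *\<^sub>R u')) \<le> FI.nrm (u - u')"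
proof -
  have "FI.nrm (lam_bound *\<^sub>R (bT u - bT u') - (lam_bound - 1) *\<^sub>R (u - u')) \<le> FI.nrm (u - u')"
    unfolding lam_bound_eq
  proof (rule FI.forward_backward_averaged)
    show "1 < 2 * (\<eta> * \<beta>)" using \<eta>\<beta>(1) by simp
    show "\<eta> * \<beta> * (FI.nrm (bB u - bB u'))\<^sup>2 \<le> K_inner \<omega> (bF (bB u - bB u')) (u - u')"
      by (rule B_op_cocoercive[OF assms])
    have "(u - bB u) - (u' - bB u') = (u - u') - (bB u - bB u')" by simp
    then show "0 \<le> K_inner \<omega> (bF (u - u' - (bB u - bB u') - (bT u - bT u'))) (bT u - bT u')"
      using resolvent_A_op_monotone[of "u - bB u" "u' - bB u'"] assms
      by (simp only: K_closed B_op_mem)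
  qed
  then show ?thesis by (simp add: algebra_simps)
qed

text \<open>
  For \<open>w = T z\<close>, the definition of the resolvent gives \<open>z - B z - w \<in> A w\<close>, so
  \<open>(z - w) - (B z - B w)\<close> lies in \<open>(A + B) w\<close>. Cocoercivity makes \<open>B\<close> Lipschitz with constant
  \<open>1/(\<eta>\<beta>)\<close>, and \<open>1/\<surd>\<eta>\<close> converts the preconditioned norm to the weighted one.
\<close>
lemma distance_le_residual:
  assumes "z \<in> K_space G"
  shows "K_dist0 \<omega> (bB (bT z) +o bA (bT z))
    \<le> ereal ((1 + 1 / (\<eta> * \<beta>)) / sqrt \<eta> * FI.nrm (z - bT z))"
proof -
  define w where "w = bT z"
  have zB: "z - bB z \<in> K_space G" using assms by (intro K_closed B_op_mem)
  then have w: "w \<in> K_space G" unfolding w_def by (rule resolvent_A_op_mem)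
  define s where "s = bB w + (z - bB z - w)"
  have "s \<in> bB w +o bA w"
    unfolding s_def w_def by (rule set_plus_intro2) (rule resolvent_A_op_in[OF zB])
  then have 1: "K_dist0 \<omega> (bB w +o bA w) \<le> ereal (K_norm \<omega> s)"
    unfolding K_dist0_def by (rule INF_lower)
  define b where "b = bB z - bB w"
  have "(\<eta> * \<beta>) * FI.nrm b * FI.nrm b \<le> FI.nrm (z - w) * FI.nrm b"
    using B_op_cocoercive[OF assms w] FI.ip_le_nrm_mult[of b "z - w"]
    by (simp add: b_def power2_eq_square mult_ac)
  then have "(\<eta> * \<beta>) * FI.nrm b \<le> FI.nrm (z - w)"
    using FI.nrm_nonneg[of b] FI.nrm_nonneg[of "z - w"] by (cases "FI.nrm b = 0") auto
  then have "FI.nrm b \<le> FI.nrm (z - w) / (\<eta> * \<beta>)"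
    using \<eta>\<beta>(2) \<beta>_pos by (simp add: pos_le_divide_eq mult.commute)
  moreover have "FI.nrm s \<le> FI.nrm (z - w) + FI.nrm b"
    using FI.nrm_triangle_diff[of "z - w" b] by (simp add: s_def b_def algebra_simps)
  ultimately have "FI.nrm s \<le> (1 + 1 / (\<eta> * \<beta>)) * FI.nrm (z - w)"
    by (simp add: distrib_right)
  then have "sqrt \<eta> * K_norm \<omega> s \<le> (1 + 1 / (\<eta> * \<beta>)) * FI.nrm (z - w)"
    using KI_nrm_le_FI_nrm[of s] unfolding K_norm_eq by linarith
  then have "K_norm \<omega> s \<le> (1 + 1 / (\<eta> * \<beta>)) / sqrt \<eta> * FI.nrm (z - w)"
    using \<eta>\<beta>(2) by (simp add: field_simps)
  then show ?thesis using 1 unfolding w_def by (meson ereal_less_eq(3) order_trans)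
qed

text \<open>
  The Krasnoselskii--Mann estimate for \<open>N = c T - (c - 1) Id\<close>, where \<open>c\<close> is \<open>lam_bound\<close>. As
  \<open>N u - u = c (T u - u)\<close>, the relaxation parameters are divided by \<open>c\<close> and the errors multiplied by it.
\<close>
lemma inexact_iteration_rate:
  assumes z: "\<And>k. z k \<in> K_space G" and fp: "zf \<in> K_space G" "bT zf = zf"
    and step: "\<And>k. z (Suc k) = z k + lam k *\<^sub>R (bT (z k) + e k - z k)"
    and lam: "\<And>k. a \<le> lam k" "\<And>k. lam k \<le> b" "0 < a" "b < lam_bound"
    and summ: "summable (\<lambda>k. real (k + 1) * FI.nrm (e k))"
  shows "\<exists>M. \<forall>k. K_dist0 \<omega> (bB (bT (z k)) +o bA (bT (z k))) \<le> ereal (M / sqrt (real (k + 1)))"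
proof -
  define N where "N u = lam_bound *\<^sub>R bT u - (lam_bound - 1) *\<^sub>R u" for u
  have N: "N u - u = lam_bound *\<^sub>R (bT u - u)" for u by (simp add: N_def algebra_simps)
  have "\<exists>M. \<forall>k. FI.nrm (z k - N (z k)) \<le> M / sqrt (real (k + 1))"
  proof (rule FI.inexact_krasnoselskii_mann_rate[where N = N and z = z and S = "K_space G"
        and e = "\<lambda>k. lam_bound *\<^sub>R e k" and \<theta> = "\<lambda>k. lam k / lam_bound"
        and a = "a / lam_bound" and b = "b / lam_bound" and zf = zf])
    show "FI.nrm (N u - N u') \<le> FI.nrm (u - u')" if "u \<in> K_space G" "u' \<in> K_space G" for u u'
      unfolding N_def by (rule T_averaged[OF that])
    show "N zf = zf" using N[of zf] fp(2) by simp
    show "z (Suc k) = z k + (lam k / lam_bound) *\<^sub>R (N (z k) + lam_bound *\<^sub>R e k - z k)" for k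
    proof -
      have "N (z k) + lam_bound *\<^sub>R e k - z k = lam_bound *\<^sub>R (bT (z k) + e k - z k)"
        using N[of "z k"] by (simp add: algebra_simps)
      then show ?thesis using lam_bound_pos by (simp add: step)
    qed
    show "summable (\<lambda>k. real (k + 1) * FI.nrm (lam_bound *\<^sub>R e k))"
      using summable_mult[OF summ, of lam_bound] lam_bound_pos by (simp add: FI.nrm_scaleR mult_ac)
  qed (use z fp lam lam_bound_pos in \<open>auto simp: divide_right_mono\<close>)
  then obtain M where M: "\<And>k. FI.nrm (z k - N (z k)) \<le> M / sqrt (real (k + 1))" by blast
  define K where "K = (1 + 1 / (\<eta> * \<beta>)) / sqrt \<eta>"
  have "0 \<le> K" unfolding K_def using \<eta>\<beta>(2) \<beta>_pos by simp
  have "K * FI.nrm (z k - bT (z k)) \<le> (K * M / lam_bound) / sqrt (real (k + 1))" for k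
  proof -
    have "z k - N (z k) = lam_bound *\<^sub>R (z k - bT (z k))" by (simp add: N_def algebra_simps)
    then have "FI.nrm (z k - bT (z k)) \<le> M / sqrt (real (k + 1)) / lam_bound"
      using M[of k] lam_bound_pos by (simp add: FI.nrm_scaleR pos_le_divide_eq mult_ac)
    from mult_left_mono[OF this \<open>0 \<le> K\<close>] show ?thesis by (simp add: mult.commute)
  qed
  then have "K_dist0 \<omega> (bB (bT (z k)) +o bA (bT (z k)))
      \<le> ereal ((K * M / lam_bound) / sqrt (real (k + 1)))" for k
    using distance_le_residual[OF z, of k] unfolding K_def[symmetric]
    by (meson ereal_less_eq(3) order_trans)
  then show ?thesis by blast
qed

section \<open>The splitting iteration as a perturbed resolvent step\<close>

text \<open>
  The diagonal scalings of \<open>F \<epsilon>1\<close> cancel against the subtracted term, and so do the adjoints between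
  \<open>D \<epsilon>1\<close> and \<open>F \<epsilon>1\<close>. Only the coupling of the dual rows to the primal error survives; it
  accounts for the extrapolated point being computed from the perturbed primal point.
\<close>
lemma forward_error_coordinates:
  fixes \<epsilon>1 \<epsilon>3 :: "'h \<times> ('g ^ 'n)"
  defines "f \<equiv> bD \<epsilon>1 + bF \<epsilon>1 + \<epsilon>3 - ((1 / \<tau>) *\<^sub>R fst \<epsilon>1, \<chi> i. (1 / \<sigma> i) *\<^sub>R (snd \<epsilon>1 $ i))"
  shows "fst f = fst \<epsilon>3" "snd f $ i = snd \<epsilon>3 $ i - 2 *\<^sub>R L i (fst \<epsilon>1)"
  unfolding f_def by (simp_all add: D_op_simps F_op_simps scaleR_2)

lemma forward_error_mem:
  assumes "\<epsilon>3 \<in> K_space G"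
  shows "bD \<epsilon>1 + bF \<epsilon>1 + \<epsilon>3 - ((1 / \<tau>) *\<^sub>R fst \<epsilon>1, \<chi> i. (1 / \<sigma> i) *\<^sub>R (snd \<epsilon>1 $ i)) \<in> K_space G"
  using assms unfolding K_space_iff forward_error_coordinates by (auto intro: G_closed L_mem)

text \<open>
  Applying \<open>F\<close> to the argument of the resolvent clears the inverses of \<open>F\<close>, and the
  coordinates of the result, scaled by \<open>\<tau>\<close> and \<open>\<sigma>\<^sub>i\<close>, are the arguments of the individual resolvents.
\<close>
lemma splitting_step_eq_resolvent:
  fixes \<epsilon>1 \<epsilon>3 u :: "'h \<times> ('g ^ 'n)"
  assumes u: "u \<in> K_space G" and "\<epsilon>3 \<in> K_space G"
  defines "\<epsilon>2 \<equiv> invF (bD \<epsilon>1 + bF \<epsilon>1 + \<epsilon>3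
      - ((1 / \<tau>) *\<^sub>R fst \<epsilon>1, \<chi> i. (1 / \<sigma> i) *\<^sub>R (snd \<epsilon>1 $ i)))"
  defines "p \<equiv> resolvent (scale_op \<tau> C)
      (fst u - \<tau> *\<^sub>R ((\<Sum>i\<in>UNIV. \<omega> i *\<^sub>R adjoint (L i) (snd u $ i)) + B (fst u) + fst \<epsilon>3))"
  shows "resolvent bA (u - bB u - \<epsilon>2) = (p, \<chi> i. resolvent (scale_op (\<sigma> i) (inverse_op (A i)))
      (snd u $ i + \<sigma> i *\<^sub>R (L i (2 *\<^sub>R (p + fst \<epsilon>1) - fst u)
        - the_elem (inverse_op (D i) (snd u $ i)) - snd \<epsilon>3 $ i - r i)))"
proof -
  define f where "f = bD \<epsilon>1 + bF \<epsilon>1 + \<epsilon>3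
      - ((1 / \<tau>) *\<^sub>R fst \<epsilon>1, \<chi> i. (1 / \<sigma> i) *\<^sub>R (snd \<epsilon>1 $ i))"
  have f_mem: "f \<in> K_space G" unfolding f_def by (rule forward_error_mem[OF assms(2)])
  have f_coord: "fst f = fst \<epsilon>3" "\<And>i. snd f $ i = snd \<epsilon>3 $ i - 2 *\<^sub>R L i (fst \<epsilon>1)"
    unfolding f_def by (rule forward_error_coordinates)+
  have \<epsilon>2: "\<epsilon>2 = invF f" by (simp add: \<epsilon>2_def f_def)
  define g where "g = bF (u - bB u - \<epsilon>2)"
  have "u - bB u - \<epsilon>2 \<in> K_space G"
    unfolding \<epsilon>2 by (intro K_closed u B_op_mem invF_mem f_mem)
  then have J: "resolvent bA (u - bB u - \<epsilon>2) = sweep g"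
    unfolding g_def by (rule resolvent_A_op)
  have g: "g = bF u - bE u - f"
    unfolding g_def linear_diff[OF linear_F_op] F_op_B_op[OF u] \<epsilon>2 F_op_invF[OF f_mem] ..
  have fst_g': "fst g = (1 / \<tau>) *\<^sub>R fst u - (\<Sum>i\<in>UNIV. \<omega> i *\<^sub>R adjoint (L i) (snd u $ i)) - B (fst u) - fst \<epsilon>3"
    unfolding g fst_diff f_coord F_op_simps E_op_simps ..
  have fst_g: "\<tau> *\<^sub>R fst g
      = fst u - \<tau> *\<^sub>R ((\<Sum>i\<in>UNIV. \<omega> i *\<^sub>R adjoint (L i) (snd u $ i)) + B (fst u) + fst \<epsilon>3)"
    using \<tau>\<sigma>(1) unfolding fst_g' by (simp add: scaleR_diff_right scaleR_add_right)
  have snd_g': "snd g $ i = (1 / \<sigma> i) *\<^sub>R (snd u $ i) - L i (fst u) - the_elem (inverse_op (D i) (snd u $ i))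
      - (snd \<epsilon>3 $ i - 2 *\<^sub>R L i (fst \<epsilon>1))" for i
    unfolding g snd_diff vector_minus_component f_coord F_op_simps E_op_simps ..
  have snd_g: "\<sigma> i *\<^sub>R (snd g $ i + 2 *\<^sub>R L i p - r i)
      = snd u $ i + \<sigma> i *\<^sub>R (L i (2 *\<^sub>R (p + fst \<epsilon>1) - fst u)
        - the_elem (inverse_op (D i) (snd u $ i)) - snd \<epsilon>3 $ i - r i)" for i
    using \<tau>\<sigma>(2)[of i] unfolding snd_g'
    by (simp add: linear_diff[OF L_linear] linear_add[OF L_linear] linear_scale[OF L_linear]
        algebra_simps)
  show ?thesis
    unfolding J sweep_def fst_g p_def[symmetric] Let_def snd_g ..
qed

text \<open>
  Nonexpansiveness of the resolvent reduces the aggregated error to the sizes of the two perturbations, one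
  inside and one outside the resolvent.
\<close>
lemma aggregated_error_bound:
  shows "\<exists>c. \<forall>w\<in>K_space G. \<forall>\<epsilon>1. \<forall>\<epsilon>3\<in>K_space G.
    FI.nrm (resolvent bA (w - invF (bD \<epsilon>1 + bF \<epsilon>1 + \<epsilon>3
        - ((1 / \<tau>) *\<^sub>R fst \<epsilon>1, \<chi> i. (1 / \<sigma> i) *\<^sub>R (snd \<epsilon>1 $ i)))) + \<epsilon>1 - resolvent bA w)
      \<le> c * (total_norm \<epsilon>1 + total_norm \<epsilon>3)"
proof -
  obtain m where m: "\<And>u. FI.nrm u \<le> m * total_norm u" using FI_nrm_le_total_norm by blast
  define l where "l = (\<Sum>i\<in>UNIV. onorm (L i))"
  have "0 \<le> l" unfolding l_def by (intro sum_nonneg onorm_pos_le L(1))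
  define c where "c = \<bar>m\<bar> + (1 + 2 * l) / sqrt \<eta>"
  have "FI.nrm (resolvent bA (w - invF (bD \<epsilon>1 + bF \<epsilon>1 + \<epsilon>3
        - ((1 / \<tau>) *\<^sub>R fst \<epsilon>1, \<chi> i. (1 / \<sigma> i) *\<^sub>R (snd \<epsilon>1 $ i)))) + \<epsilon>1 - resolvent bA w)
      \<le> c * (total_norm \<epsilon>1 + total_norm \<epsilon>3)"
    if w: "w \<in> K_space G" and \<epsilon>3: "\<epsilon>3 \<in> K_space G" for w \<epsilon>1 \<epsilon>3
  proof -
    define f where "f = bD \<epsilon>1 + bF \<epsilon>1 + \<epsilon>3
        - ((1 / \<tau>) *\<^sub>R fst \<epsilon>1, \<chi> i. (1 / \<sigma> i) *\<^sub>R (snd \<epsilon>1 $ i))"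
    have f: "f \<in> K_space G" unfolding f_def by (rule forward_error_mem[OF \<epsilon>3])
    define t1 t3 where "t1 = total_norm \<epsilon>1" and "t3 = total_norm \<epsilon>3"
    have t: "0 \<le> t1" "0 \<le> t3" "norm (fst \<epsilon>1) \<le> t1"
      unfolding t1_def t3_def using total_norm_nonneg by (auto simp: total_norm_def sum_nonneg)
    have "norm (snd f $ i) \<le> norm (snd \<epsilon>3 $ i) + 2 * t1 * onorm (L i)" for i
    proof -
      have "norm (snd f $ i) \<le> norm (snd \<epsilon>3 $ i) + norm (2 *\<^sub>R L i (fst \<epsilon>1))"
        unfolding f_def forward_error_coordinates by (rule norm_triangle_ineq4)
      also have "norm (L i (fst \<epsilon>1)) \<le> onorm (L i) * t1"
        using onorm[OF L(1), of i "fst \<epsilon>1"] mult_left_mono[OF t(3) onorm_pos_le[OF L(1)], of i]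
        by linarith
      then have "norm (2 *\<^sub>R L i (fst \<epsilon>1)) \<le> 2 * t1 * onorm (L i)" by (simp add: mult.commute)
      finally show ?thesis by simp
    qed
    then have "(\<Sum>i\<in>UNIV. norm (snd f $ i))
        \<le> (\<Sum>i\<in>UNIV. norm (snd \<epsilon>3 $ i) + 2 * t1 * onorm (L i))" by (rule sum_mono)
    also have "\<dots> = (\<Sum>i\<in>UNIV. norm (snd \<epsilon>3 $ i)) + 2 * t1 * l"
      by (simp add: l_def sum.distrib sum_distrib_left)
    finally have "total_norm f \<le> t3 + 2 * t1 * l"
      unfolding total_norm_def[of f] t3_def total_norm_def[of \<epsilon>3]
      unfolding f_def forward_error_coordinates by simp
    also have "\<dots> \<le> (1 + 2 * l) * (t1 + t3)" using t \<open>0 \<le> l\<close> by (simp add: algebra_simps)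
    finally have "sqrt \<eta> * FI.nrm (invF f) \<le> (1 + 2 * l) * (t1 + t3)"
      using FI_nrm_invF_le[OF f] KI_nrm_le_total_norm[of f] by linarith
    then have e2: "FI.nrm (invF f) \<le> (1 + 2 * l) / sqrt \<eta> * (t1 + t3)"
      using \<eta>\<beta>(2) by (simp add: field_simps)
    have "FI.nrm \<epsilon>1 \<le> m * t1" unfolding t1_def by (rule m)
    also have "\<dots> \<le> \<bar>m\<bar> * (t1 + t3)" using t by (intro mult_mono) auto
    finally have e1: "FI.nrm \<epsilon>1 \<le> \<bar>m\<bar> * (t1 + t3)" .
    have "FI.nrm (resolvent bA (w - invF f) - resolvent bA w) \<le> FI.nrm ((w - invF f) - w)"
      by (intro resolvent_A_op_nonexpansive K_closed w invF_mem f)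
    also have "\<dots> = FI.nrm (invF f)" using FI.nrm_scaleR[of "-1" "invF f"] by simp
    finally have "FI.nrm ((resolvent bA (w - invF f) - resolvent bA w) + \<epsilon>1)
        \<le> FI.nrm (invF f) + FI.nrm \<epsilon>1"
      using FI.nrm_triangle[of "resolvent bA (w - invF f) - resolvent bA w" \<epsilon>1] by linarith
    also have "\<dots> \<le> c * (t1 + t3)" using e1 e2 by (simp add: c_def distrib_right)
    finally show ?thesis unfolding f_def t1_def t3_def by (simp add: algebra_simps)
  qed
  then show ?thesis by blast
qed

end

theorem proposition4:
  fixes C :: "'h::{real_inner, complete_space} \<Rightarrow> 'h set"
    and B :: "'h \<Rightarrow> 'h"
    and G :: "'n::finite \<Rightarrow> 'g::{real_inner, complete_space} set"
    and A D :: "'n \<Rightarrow> 'g \<Rightarrow> 'g set"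
    and L :: "'n \<Rightarrow> 'h \<Rightarrow> 'g"
    and r :: "'n \<Rightarrow> 'g"
    and \<mu> \<tau> \<eta> \<beta> \<delta> \<tau>inf d0 :: real
    and \<omega> \<nu> \<sigma> :: "'n \<Rightarrow> real"
    and lam :: "nat \<Rightarrow> real"
    and eps1 eps2 p x y :: "nat \<Rightarrow> 'h"
    and eps3 eps4 q v :: "nat \<Rightarrow> 'g ^ 'n"
    and bC bA :: "'h \<times> ('g ^ 'n) \<Rightarrow> ('h \<times> ('g ^ 'n)) set"
    and bD bE bF invF bB bT :: "'h \<times> ('g ^ 'n) \<Rightarrow> 'h \<times> ('g ^ 'n)"
    and fixT :: "('h \<times> ('g ^ 'n)) set"
    and z beps1 beps2 beps3 beps4 beps w :: "nat \<Rightarrow> 'h \<times> ('g ^ 'n)"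
  assumes G: "\<And>i. subspace (G i)" "\<And>i. closed (G i)"
    and C: "maximal_monotone_on UNIV C"
    and B: "\<mu> > 0" "cocoercive \<mu> B"
    and \<omega>: "\<And>i. 0 < \<omega> i \<and> \<omega> i < 1" "(\<Sum>i\<in>UNIV. \<omega> i) = 1"
    and r: "\<And>i. r i \<in> G i"
    and A: "\<And>i. maximal_monotone_on (G i) (A i)"
    and D: "\<And>i. maximal_monotone_on (G i) (D i)" "\<And>i. \<nu> i > 0"
      "\<And>i. strongly_monotone (\<nu> i) (D i)"
    and L: "\<And>i. bounded_linear (L i)" "\<And>i. range (L i) \<subseteq> G i" "\<And>i. L i \<noteq> (\<lambda>_. 0)"
    \<comment> \<open>parameters\<close>
    and \<tau>\<sigma>: "\<tau> > 0" "\<And>i. \<sigma> i > 0"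
    and \<eta>_def: "\<eta> = Min (insert (1 / \<tau>) (range (\<lambda>i. 1 / \<sigma> i)))
                    * (1 - sqrt (\<tau> * (\<Sum>i\<in>UNIV. \<sigma> i * \<omega> i * (onorm (L i))\<^sup>2)))"
    and \<beta>_def: "\<beta> = Min (insert \<mu> (range \<nu>))"
    and \<eta>\<beta>: "2 * \<eta> * \<beta> > 1" "\<eta> > 0"
    and lam: "\<And>k. 0 < lam k \<and> lam k \<le> (4 * \<eta> * \<beta> - 1) / (2 * \<eta> * \<beta>)"
    and eps_mem: "\<And>k i. eps3 k $ i \<in> G i" "\<And>k i. eps4 k $ i \<in> G i"
    and eps_summable: "summable (\<lambda>k. norm (eps1 k))" "summable (\<lambda>k. norm (eps2 k))"
      "\<And>i. summable (\<lambda>k. norm (eps3 k $ i))" "\<And>i. summable (\<lambda>k. norm (eps4 k $ i))"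
    \<comment> \<open>iteration\<close>
    and v0: "\<And>i. v 0 $ i \<in> G i"
    and p: "\<And>k. p (Suc k) = resolvent (scale_op \<tau> C)
              (x k - \<tau> *\<^sub>R ((\<Sum>i\<in>UNIV. \<omega> i *\<^sub>R adjoint (L i) (v k $ i)) + B (x k) + eps1 k))
              + eps2 k"
    and y: "\<And>k. y (Suc k) = 2 *\<^sub>R p (Suc k) - x k"
    and x: "\<And>k. x (Suc k) = x k + lam k *\<^sub>R (p (Suc k) - x k)"
    and q: "\<And>k i. q (Suc k) $ i = resolvent (scale_op (\<sigma> i) (inverse_op (A i)))
              (v k $ i + \<sigma> i *\<^sub>R (L i (y (Suc k)) - the_elem (inverse_op (D i) (v k $ i))
                                     - eps3 k $ i - r i))
              + eps4 k $ i"
    and v: "\<And>k i. v (Suc k) $ i = v k $ i + lam k *\<^sub>R (q (Suc k) $ i - v k $ i)"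
    \<comment> \<open>product form\<close>
    and bC_def: "bC = C_op C A r"
    and bD_def: "bD = D_op \<omega> L"
    and bE_def: "bE = E_op B D"
    and bF_def: "bF = F_op \<tau> \<sigma> \<omega> L"
    and invF_def: "invF = inv_into (K_space G) bF"
    and bA_def: "bA = (\<lambda>u. invF ` (bD u +o bC u))"
    and bB_def: "bB = (\<lambda>u. invF (bE u))"
    and bT_def: "bT = (\<lambda>u. resolvent bA (u - bB u))"
    and fixT_def: "fixT = {u \<in> K_space G. bT u = u}"
    and fixT: "fixT \<noteq> {}"
    and z_def: "\<And>k. z k = (x k, v k)"
    and beps1_def: "\<And>k. beps1 k = (eps2 k, eps4 k)"
    and beps3_def: "\<And>k. beps3 k = (eps1 k, eps3 k)"
    and beps4_def: "\<And>k. beps4 k = ((1 / \<tau>) *\<^sub>R eps2 k, \<chi> i. (1 / \<sigma> i) *\<^sub>R (eps4 k $ i))"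
    and beps2_def: "\<And>k. beps2 k = invF (bD (beps1 k) + bF (beps1 k) + beps3 k - beps4 k)"
    and beps_def: "\<And>k. beps k = (resolvent bA (z k - bB (z k) - beps2 k) + beps1 k)
                               - resolvent bA (z k - bB (z k))"
    and w: "\<And>k. w (Suc k) = (1 / lam k) *\<^sub>R (z (Suc k) - (1 - lam k) *\<^sub>R z k) - beps k"
    and \<delta>_def: "\<delta> = Max (insert (1 / \<tau>) (range (\<lambda>i. 1 / \<sigma> i)))"
    and \<tau>inf_def: "\<tau>inf = (INF k. lam k * ((4 * \<eta> * \<beta> - 1) / (2 * \<eta> * \<beta>) - lam k))"
    and d0_def: "d0 = (INF u\<in>fixT. K_norm \<omega> (z 0 - u))"
    \<comment> \<open>hypotheses of the rate estimate\<close>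
    and lam_bounds: "0 < (INF k. lam k)" "(SUP k. lam k) < (4 * \<eta> * \<beta> - 1) / (2 * \<eta> * \<beta>)"
    and eps12_rate: "summable (\<lambda>k. real (k + 1) * norm (eps1 k))"
      "summable (\<lambda>k. real (k + 1) * norm (eps2 k))"
    and eps34_rate: "\<And>i. summable (\<lambda>k. real (k + 1) * norm (eps3 k $ i))"
      "\<And>i. summable (\<lambda>k. real (k + 1) * norm (eps4 k $ i))"
  shows "\<exists>C1::real. \<forall>k::nat.
           K_dist0 \<omega> (bB (w (Suc k)) +o bA (w (Suc k)))
             \<le> ereal (2 * \<delta> / \<eta> * sqrt ((d0\<^sup>2 + C1) / (\<tau>inf * real (k + 1))))"
proof -
  interpret P: primal_dual C B G A D L r \<mu> \<tau> \<eta> \<beta> \<omega> \<nu> \<sigma>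
    by (rule primal_dual.intro) (fact G C B \<omega> r A D L \<tau>\<sigma> \<eta>_def \<beta>_def \<eta>\<beta>)+
  have invF: "invF = P.invF" by (simp only: invF_def bF_def)
  have bA: "bA = P.bA" by (simp only: bA_def invF bD_def bC_def)
  have bB: "bB = P.bB" by (simp only: bB_def invF bE_def)
  have beps1_mem: "beps1 k \<in> K_space G" and beps3_mem: "beps3 k \<in> K_space G" for k
    using eps_mem by (simp_all add: beps1_def beps3_def P.K_space_iff)
  \<comment> \<open>The error inside the resolvent before \<open>F\<close> is inverted.\<close>
  define f where "f k = P.bD (beps1 k) + P.bF (beps1 k) + beps3 k
      - ((1 / \<tau>) *\<^sub>R fst (beps1 k), \<chi> i. (1 / \<sigma> i) *\<^sub>R (snd (beps1 k) $ i))" for k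
  have f: "beps2 k = P.invF (f k)" for k
    by (simp only: beps2_def invF bD_def bF_def beps4_def f_def beps1_def fst_conv snd_conv)
  have f_mem: "f k \<in> K_space G" for k
    unfolding f_def by (rule P.forward_error_mem[OF beps3_mem])

  define J where "J k = resolvent bA (z k - bB (z k) - beps2 k)" for k
  have J: "J k + beps1 k = (p (Suc k), q (Suc k))" if "z k \<in> K_space G" for k
  proof -
    have "J k = (p (Suc k) - eps2 k, \<chi> i. q (Suc k) $ i - eps4 k $ i)"
      unfolding J_def bA bB f f_def
      unfolding P.splitting_step_eq_resolvent[OF that beps3_mem]
      by (simp add: z_def beps1_def beps3_def p y q)
    then show ?thesis by (simp add: beps1_def vec_eq_iff)
  qed
  have z_Suc: "z (Suc k) = z k + lam k *\<^sub>R (J k + beps1 k - z k)" if "z k \<in> K_space G" for k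
    unfolding J[OF that] by (simp add: z_def x v vec_eq_iff)
  have z_mem: "z k \<in> K_space G" for k
  proof (induction k)
    case 0
    show ?case using v0 by (simp add: z_def P.K_space_iff)
  next
    case (Suc k)
    have "J k \<in> K_space G"
      unfolding J_def bA bB f by (intro P.resolvent_A_op_mem P.K_closed P.B_op_mem P.invF_mem f_mem Suc)
    then show ?case unfolding z_Suc[OF Suc] by (intro P.K_closed beps1_mem Suc)
  qed
  have step: "z (Suc k) = z k + lam k *\<^sub>R (P.bT (z k) + beps k - z k)" for k
    unfolding z_Suc[OF z_mem] beps_def J_def bA bB by simp
  \<comment> \<open>Removing the relaxation and the error from \<open>z (Suc k)\<close> leaves the exact image under \<open>T\<close>.\<close>
  have w_eq: "w (Suc k) = P.bT (z k)" for k
  proof -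
    have "z (Suc k) - (1 - lam k) *\<^sub>R z k = lam k *\<^sub>R (P.bT (z k) + beps k)"
      unfolding step by (simp add: algebra_simps)
    then show ?thesis using lam[of k] by (simp add: w)
  qed

  obtain c where c: "P.FI.nrm (beps k) \<le> c * (P.total_norm (beps1 k) + P.total_norm (beps3 k))" for k
    using P.aggregated_error_bound z_mem beps3_mem P.B_op_mem P.K_closed
    unfolding beps_def bA bB f f_def by meson
  have "summable (\<lambda>k. c * (real (k + 1) * norm (eps2 k) + (\<Sum>i\<in>UNIV. real (k + 1) * norm (eps4 k $ i))
      + (real (k + 1) * norm (eps1 k) + (\<Sum>i\<in>UNIV. real (k + 1) * norm (eps3 k $ i)))))"
    by (intro summable_mult summable_add summable_sum eps12_rate eps34_rate)
  then have errors: "summable (\<lambda>k. real (k + 1) * P.FI.nrm (beps k))"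
  proof (rule summable_comparison_test'[where N = 0])
    fix k
    have "real (k + 1) * P.FI.nrm (beps k)
        \<le> real (k + 1) * (c * (P.total_norm (beps1 k) + P.total_norm (beps3 k)))"
      by (intro mult_left_mono c) simp
    also have "\<dots> = c * (real (k + 1) * norm (eps2 k) + (\<Sum>i\<in>UNIV. real (k + 1) * norm (eps4 k $ i))
        + (real (k + 1) * norm (eps1 k) + (\<Sum>i\<in>UNIV. real (k + 1) * norm (eps3 k $ i))))"
      unfolding P.total_norm_def beps1_def beps3_def fst_conv snd_conv sum_distrib_left[symmetric]
      by (simp only: ring_distribs mult_ac)
    finally show "norm (real (k + 1) * P.FI.nrm (beps k)) \<le> \<dots>" by simp
  qed

  define lmin lmax where "lmin = (INF k. lam k)" and "lmax = (SUP k. lam k)"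
  have lmin: "lmin \<le> lam k" for k
    unfolding lmin_def using lam by (intro cINF_lower bdd_belowI[of _ 0]) (auto intro: less_imp_le)
  have lmax: "lam k \<le> lmax" for k
    unfolding lmax_def using lam
    by (intro cSUP_upper bdd_aboveI[of _ "(4 * \<eta> * \<beta> - 1) / (2 * \<eta> * \<beta>)"]) auto
  obtain zf where "zf \<in> K_space G" "P.bT zf = zf"
    using fixT unfolding fixT_def bT_def bA bB by blast
  then obtain M where M: "K_dist0 \<omega> (P.bB (P.bT (z k)) +o P.bA (P.bT (z k)))
      \<le> ereal (M / sqrt (real (k + 1)))" for k
    using P.inexact_iteration_rate[OF z_mem _ _ step lmin lmax _ _ errors] lam_bounds
    unfolding P.lam_bound_def lmin_def lmax_def by blast

  have "0 < lmin * ((4 * \<eta> * \<beta> - 1) / (2 * \<eta> * \<beta>) - lmax)"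
    using lam_bounds unfolding lmin_def lmax_def by simp
  also have "\<dots> \<le> \<tau>inf"
    unfolding \<tau>inf_def
  proof (rule cINF_greatest)
    fix k
    show "lmin * ((4 * \<eta> * \<beta> - 1) / (2 * \<eta> * \<beta>) - lmax)
        \<le> lam k * ((4 * \<eta> * \<beta> - 1) / (2 * \<eta> * \<beta>) - lam k)"
      using lmin[of k] lmax[of k] lam[of k] lam_bounds unfolding lmax_def
      by (intro mult_mono) (auto intro: less_imp_le)
  qed simp
  finally have \<tau>inf: "0 < \<tau>inf" .
  have "1 / \<tau> \<le> \<delta>" unfolding \<delta>_def by (intro Max_ge; simp)
  then have \<delta>: "0 < \<delta>" using \<tau>\<sigma>(1) by (meson divide_pos_pos less_le_trans zero_less_one)

  \<comment> \<open>The witness \<open>\<tau>inf * m\<^sup>2\<close> for \<open>C1\<close> makes the bound at least \<open>\<bar>M\<bar> / \<surd>(k + 1)\<close> already for \<open>d0 = 0\<close>.\<close>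
  define m where "m = \<bar>M\<bar> * \<eta> / (2 * \<delta>)"
  have "ereal (M / sqrt (real (k + 1)))
      \<le> ereal (2 * \<delta> / \<eta> * sqrt ((d0\<^sup>2 + \<tau>inf * m\<^sup>2) / (\<tau>inf * real (k + 1))))" for k
  proof -
    have "M / sqrt (real (k + 1)) \<le> \<bar>M\<bar> / sqrt (real (k + 1))"
      by (intro divide_right_mono) auto
    also have "\<dots> = 2 * \<delta> / \<eta> * sqrt (m\<^sup>2 / real (k + 1))"
      using \<delta> \<eta>\<beta>(2) by (simp add: m_def real_sqrt_divide)
    also have "m\<^sup>2 / real (k + 1) = \<tau>inf * m\<^sup>2 / (\<tau>inf * real (k + 1))" using \<tau>inf by simp
    also have "2 * \<delta> / \<eta> * sqrt (\<tau>inf * m\<^sup>2 / (\<tau>inf * real (k + 1)))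
        \<le> 2 * \<delta> / \<eta> * sqrt ((d0\<^sup>2 + \<tau>inf * m\<^sup>2) / (\<tau>inf * real (k + 1)))"
      using \<delta> \<eta>\<beta>(2) \<tau>inf by (intro mult_left_mono real_sqrt_le_mono divide_right_mono) auto
    finally show ?thesis by simp
  qed
  then show ?thesis
    using M unfolding w_eq bA bB by (intro exI[of _ "\<tau>inf * m\<^sup>2"]) (meson order_trans)
qed

end
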